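(* For all $n,k\ge1$, as formal power series in the variables $q_{i,j}$, $$\frac{\mathrm{Hilb}(\mathbb C[X_1,\ldots,X_k]^{\Delta S_n})(Q_1,\ldots,Q_k)}{\mathrm{Hilb}(\mathbb C[X_1,\ldots,X_k]^{S_n^k})(Q_1,\ldots,Q_k)}=\sum_{(\sigma_1,\ldots,\sigma_k)\in W^{(k)}}Q_1^{\lambda(\sigma_1)}\cdots Q_k^{\lambda(\sigma_k)}.$$
   Context: $\mathbb C[X_1,\ldots,X_k]$ is the polynomial ring in variables $x_{i,j}$ ($i\in[k]$, $j\in[n]$), with $X_i=(x_{i,1},\ldots,x_{i,n})$. $S_n^k$ acts with the $i$-th factor permuting the variables of $X_i$, and $\Delta S_n$ is the diagonal subgroup. The exponent partition of a monomial in $X_i$ is its exponent vector rearranged in weakly decreasing order. For a monomial $M=m_1(X_1)\cdots m_k(X_k)$, its multipartition degree is $\Lambda(M)=(\lambda(m_1),\ldots,\lambda(m_k))$. For a partition $\lambda$ with at most $n$ parts, $Q_i^\lambda=\prod_{j=1}^nq_{i,j}^{\lambda_j}$. For $G=\Delta S_n$ or $S_n^k$, $$\mathrm{Hilb}(\mathbb C[X_1,\ldots,X_k]^G)(Q_1,\ldots,Q_k)=\sum_{(\lambda^{(1)},\ldots,\lambda^{(k)})}\dim\big(\mathbb C[X_1,\ldots,X_k]^G_{(\lambda^{(1)},\ldots,\lambda^{(k)})}\big)\,Q_1^{\lambda^{(1)}}\cdots Q_k^{\lambda^{(k)}},$$ where the sum is over $k$-tuples of partitions with at most $n$ parts, and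 the subscript denotes the $G$-invariants spanned by monomials of that multipartition degree. For $\sigma\in S_n$, $\mathrm{Des}(\sigma)=\{i\in[n-1]:\sigma(i)>\sigma(i+1)\}$ and $\lambda(\sigma)_i=|\mathrm{Des}(\sigma)\cap\{i,\ldots,n\}|$ for $i=1,\ldots,n$. Finally, $W^{(k)}=\{(\sigma_1,\ldots,\sigma_k)\in S_n^k:\sigma_1\cdots\sigma_k=1\}$. *)

theory Defs
  imports Complex_Main "HOL-Library.FuncSet" "HOL-Library.Poly_Mapping" "HOL-Combinatorics.Permutations"
begin

section \<open>Multivariate formal power series\<close>

text \<open>
  A monomial in variables of type \<open>'v\<close> is a finitely supported exponent vector
  \<open>'v \<Rightarrow>\<^sub>0 nat\<close>; a formal power series is an arbitrary family of coefficients.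
\<close>

typedef ('v, 'a) mfps = "UNIV :: (('v \<Rightarrow>\<^sub>0 nat) \<Rightarrow> 'a) set"
  morphisms mfps_coeff Abs_mfps ..

lemma mfps_eqI: "(\<And>m. mfps_coeff f m = mfps_coeff g m) \<Longrightarrow> f = g"
  by (simp add: mfps_coeff_inject[symmetric] fun_eq_iff)

lemma mfps_coeff_Abs [simp]: "mfps_coeff (Abs_mfps f) = f"
  by (simp add: Abs_mfps_inverse)

definition splits :: "('v \<Rightarrow>\<^sub>0 nat) \<Rightarrow> (('v \<Rightarrow>\<^sub>0 nat) \<times> ('v \<Rightarrow>\<^sub>0 nat)) set" where
  "splits m = {(a, b). a + b = m}"

lemma finite_splits [simp]: "finite (splits m)"
proof -
  let ?r = "\<lambda>a. restrict (Poly_Mapping.lookup a) (Poly_Mapping.keys m)"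
  let ?D = "{a. \<exists>b. a + b = m}"
  have key: "Poly_Mapping.keys a \<subseteq> Poly_Mapping.keys m" "Poly_Mapping.lookup a v \<le> Poly_Mapping.lookup m v" if "a \<in> ?D" for a v
    using that by (auto simp: lookup_add in_keys_iff)
  have "inj_on ?r ?D"
  proof (rule inj_onI)
    fix a b assume a: "a \<in> ?D" and b: "b \<in> ?D" and eq: "?r a = ?r b"
    show "a = b"
    proof (rule poly_mapping_eqI)
      fix v
      show "Poly_Mapping.lookup a v = Poly_Mapping.lookup b v"
      proof (cases "v \<in> Poly_Mapping.keys m")
        case True
        then show ?thesis using fun_cong[OF eq, of v] by simp
      next
        case False
        then have "v \<notin> Poly_Mapping.keys a" "v \<notin> Poly_Mapping.keys b" using key(1)[OF a] key(1)[OF b] by auto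
        then show ?thesis by (simp add: in_keys_iff)
      qed
    qed
  qed
  moreover have "?r ` ?D \<subseteq> (\<Pi>\<^sub>E v\<in>Poly_Mapping.keys m. {..Poly_Mapping.lookup m v})"
    using key(2) by (auto simp: PiE_def extensional_def)
  moreover have "finite (\<Pi>\<^sub>E v\<in>Poly_Mapping.keys m. {..Poly_Mapping.lookup m v})"
    by (intro finite_PiE) auto
  ultimately have fin: "finite ?D"
    by (meson finite_imageD finite_subset)
  have "splits m \<subseteq> (\<lambda>a. (a, m - a)) ` ?D"
  proof
    fix p assume "p \<in> splits m"
    then obtain a b where "p = (a, b)" "a + b = m" by (auto simp: splits_def)
    then show "p \<in> (\<lambda>a. (a, m - a)) ` ?D" by (intro image_eqI[of _ _ a]) auto
  qed
  then show ?thesis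
    using fin finite_surj by blast
qed

instantiation mfps :: (type, comm_ring_1) comm_ring_1
begin

definition "0 = Abs_mfps (\<lambda>_. 0)"
definition "1 = Abs_mfps (\<lambda>m. if m = 0 then 1 else 0)"
definition "f + g = Abs_mfps (\<lambda>m. mfps_coeff f m + mfps_coeff g m)"
definition "f - g = Abs_mfps (\<lambda>m. mfps_coeff f m - mfps_coeff g m)"
definition "- f = Abs_mfps (\<lambda>m. - mfps_coeff f m)"
definition "f * g = Abs_mfps (\<lambda>m. \<Sum>(a, b)\<in>splits m. mfps_coeff f a * mfps_coeff g b)"

instance
proof
  fix f g h :: "('a, 'b) mfps"
  show "f * g * h = f * (g * h)"
  proof (rule mfps_eqI)
    fix m
    let ?F = "mfps_coeff f" and ?G = "mfps_coeff g" and ?H = "mfps_coeff h"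
    have "mfps_coeff (f * g * h) m =
        (\<Sum>p\<in>splits m. \<Sum>q\<in>splits (fst p). ?F (fst q) * ?G (snd q) * ?H (snd p))"
      by (simp add: times_mfps_def sum_distrib_right case_prod_beta)
    also have "\<dots> = (\<Sum>(p, q)\<in>(SIGMA p:splits m. splits (fst p)). ?F (fst q) * ?G (snd q) * ?H (snd p))"
      by (subst sum.Sigma) auto
    also have "\<dots> = (\<Sum>(p, q)\<in>(SIGMA p:splits m. splits (snd p)). ?F (fst p) * (?G (fst q) * ?H (snd q)))"
      by (rule sum.reindex_bij_witness[where
          i = "\<lambda>((a, bc), (b, c)). ((a + b, c), (a, b))" and
          j = "\<lambda>((ab, c), (a, b)). ((a, b + c), (b, c))"])
        (auto simp: splits_def add.assoc mult.assoc)
    also have "\<dots> = (\<Sum>p\<in>splits m. \<Sum>q\<in>splits (snd p). ?F (fst p) * (?G (fst q) * ?H (snd q)))"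
      by (subst sum.Sigma) auto
    also have "\<dots> = mfps_coeff (f * (g * h)) m"
      by (simp add: times_mfps_def sum_distrib_left case_prod_beta)
    finally show "mfps_coeff (f * g * h) m = mfps_coeff (f * (g * h)) m" .
  qed
  show "f * g = g * f"
  proof (rule mfps_eqI)
    fix m
    have "(\<Sum>p\<in>splits m. mfps_coeff f (fst p) * mfps_coeff g (snd p)) =
        (\<Sum>p\<in>splits m. mfps_coeff g (fst p) * mfps_coeff f (snd p))"
      by (rule sum.reindex_bij_witness[where i = prod.swap and j = prod.swap])
        (auto simp: splits_def add.commute mult.commute)
    then show "mfps_coeff (f * g) m = mfps_coeff (g * f) m"
      by (simp add: times_mfps_def case_prod_beta)
  qed
  show "1 * f = f"
  proof (rule mfps_eqI)
    fix m
    have "mfps_coeff (1 * f) m = (\<Sum>p\<in>splits m. if p = (0, m) then mfps_coeff f m else 0)"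
      unfolding times_mfps_def one_mfps_def
      by (auto simp: splits_def intro!: sum.cong)
    also have "\<dots> = mfps_coeff f m"
      by simp (simp add: splits_def)
    finally show "mfps_coeff (1 * f) m = mfps_coeff f m" .
  qed
  show "(f + g) * h = f * h + g * h"
    by (rule mfps_eqI)
      (simp add: times_mfps_def plus_mfps_def case_prod_beta distrib_right sum.distrib)
  show "(0 :: ('a, 'b) mfps) \<noteq> 1"
  proof
    assume "(0 :: ('a, 'b) mfps) = 1"
    then have "mfps_coeff (0 :: ('a, 'b) mfps) 0 = mfps_coeff 1 0" by simp
    then show False by (simp add: zero_mfps_def one_mfps_def)
  qed
qed (rule mfps_eqI,
    simp add: zero_mfps_def plus_mfps_def minus_mfps_def uminus_mfps_def algebra_simps)+

end

text \<open>
  Division: \<open>f / g\<close> multiplies by the (unique) inverse of \<open>g\<close> when \<open>g\<close> is a unit; as usual it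
  is given the value 0 when \<open>g\<close> is not a unit.
\<close>

instantiation mfps :: (type, comm_ring_1) inverse
begin

definition "inverse f = (if f dvd 1 then (THE g. f * g = 1) else (0 :: ('a, 'b) mfps))"
definition "f div g = f * inverse (g :: ('a, 'b) mfps)"

instance ..

end

lemma mfps_inverse_unique:
  fixes f g :: "('v, 'a::comm_ring_1) mfps"
  assumes "f * g = 1"
  shows "inverse f = g"
proof -
  have unique: "h = g" if "f * h = 1" for h
  proof -
    have "h = h * (f * g)" by (simp add: assms)
    also have "\<dots> = (f * h) * g" by (simp only: ac_simps)
    finally show ?thesis by (simp add: that)
  qed
  have "f dvd 1" using assms by (metis dvd_triv_left)
  moreover have "(THE g. f * g = 1) = g"
    using assms unique by (rule the_equality)
  ultimately show ?thesis by (simp add: inverse_mfps_def)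
qed

definition mfps_var :: "'v \<Rightarrow> ('v, 'a::comm_ring_1) mfps" where
  "mfps_var v = Abs_mfps (\<lambda>m. if m = Poly_Mapping.single v 1 then 1 else 0)"


section \<open>Polynomials in \<open>k\<close> sets of \<open>n\<close> variables\<close>

text \<open>
  The variable \<open>x\<^bsub>i,j\<^esub>\<close> (and likewise \<open>q\<^bsub>i,j\<^esub>\<close>) is indexed by the pair \<open>(i, j)\<close>,
  with \<open>i \<in> {1..k}\<close> and \<open>j \<in> {1..n}\<close>.
\<close>

type_synonym var = "nat \<times> nat"
type_synonym monom = "var \<Rightarrow>\<^sub>0 nat"
type_synonym cpoly = "monom \<Rightarrow>\<^sub>0 complex"

definition cscale :: "complex \<Rightarrow> cpoly \<Rightarrow> cpoly" where
  "cscale c P = Poly_Mapping.single 0 c * P"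

interpretation cpoly: vector_space cscale
proof
  show "cscale a (P + R) = cscale a P + cscale a R" for a P R
    by (simp add: cscale_def algebra_simps)
  show "cscale (a + b) P = cscale a P + cscale b P" for a b P
    by (simp add: cscale_def algebra_simps single_add)
  show "cscale a (cscale b P) = cscale (a * b) P" for a b P
    by (simp add: cscale_def mult_single flip: mult.assoc)
  show "cscale 1 P = P" for P
    by (simp add: cscale_def)
qed

definition monoms :: "nat \<Rightarrow> nat \<Rightarrow> monom set" where
  "monoms n k = {M. Poly_Mapping.keys M \<subseteq> {1..k} \<times> {1..n}}"

definition poly_ring :: "nat \<Rightarrow> nat \<Rightarrow> cpoly set" where
  "poly_ring n k = {P. Poly_Mapping.keys P \<subseteq> monoms n k}"

text \<open>The action of a tuple of permutations: substitution of \<open>x\<^bsub>i,\<sigma>\<^sub>i(j)\<^esub>\<close> for \<open>x\<^bsub>i,j\<^esub>\<close>.\<close>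

definition act_monom :: "(nat \<Rightarrow> nat \<Rightarrow> nat) \<Rightarrow> monom \<Rightarrow> monom" where
  "act_monom \<sigma> M = (\<Sum>(i, j)\<in>Poly_Mapping.keys M. Poly_Mapping.single (i, \<sigma> i j) (Poly_Mapping.lookup M (i, j)))"

definition act_poly :: "(nat \<Rightarrow> nat \<Rightarrow> nat) \<Rightarrow> cpoly \<Rightarrow> cpoly" where
  "act_poly \<sigma> P = (\<Sum>M\<in>Poly_Mapping.keys P. Poly_Mapping.single (act_monom \<sigma> M) (Poly_Mapping.lookup P M))"

definition Sym :: "nat \<Rightarrow> (nat \<Rightarrow> nat) set" where
  "Sym n = {p. p permutes {1..n}}"

text \<open>Elements of \<open>S\<^sub>n\<^sup>k\<close> are functions on \<open>{1..k}\<close>, made extensional so that they are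
  counted once.\<close>

definition Sym_pow :: "nat \<Rightarrow> nat \<Rightarrow> (nat \<Rightarrow> nat \<Rightarrow> nat) set" where
  "Sym_pow n k = {1..k} \<rightarrow>\<^sub>E Sym n"

definition Sym_diag :: "nat \<Rightarrow> nat \<Rightarrow> (nat \<Rightarrow> nat \<Rightarrow> nat) set" where
  "Sym_diag n k = (\<lambda>p. \<lambda>i\<in>{1..k}. p) ` Sym n"

definition invariants :: "nat \<Rightarrow> nat \<Rightarrow> (nat \<Rightarrow> nat \<Rightarrow> nat) set \<Rightarrow> cpoly set" where
  "invariants n k G = {P \<in> poly_ring n k. \<forall>\<sigma>\<in>G. act_poly \<sigma> P = P}"


section \<open>Multipartition degree and Hilbert series\<close>

text \<open>A partition with at most \<open>n\<close> parts is padded by zeros to a list of length \<open>n\<close>; as lists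
  are indexed from 0, the part \<open>\<lambda>\<^sub>j\<close> is \<open>l ! (j - 1)\<close>.\<close>

definition partitions :: "nat \<Rightarrow> nat list set" where
  "partitions n = {l. length l = n \<and> sorted_wrt (\<ge>) l}"

definition multipartitions :: "nat \<Rightarrow> nat \<Rightarrow> (nat \<Rightarrow> nat list) set" where
  "multipartitions n k = {1..k} \<rightarrow>\<^sub>E partitions n"

definition multidegree :: "nat \<Rightarrow> nat \<Rightarrow> monom \<Rightarrow> nat \<Rightarrow> nat list" where
  "multidegree n k M = (\<lambda>i\<in>{1..k}. rev (sort (map (\<lambda>j. Poly_Mapping.lookup M (i, j)) [1..<Suc n])))"

definition graded_part :: "nat \<Rightarrow> nat \<Rightarrow> (nat \<Rightarrow> nat \<Rightarrow> nat) set \<Rightarrow> (nat \<Rightarrow> nat list) \<Rightarrow> cpoly set" where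
  "graded_part n k G \<Lambda> = invariants n k G \<inter>
     cpoly.span {Poly_Mapping.single M 1 |M. M \<in> monoms n k \<and> multidegree n k M = \<Lambda>}"

definition Qpow :: "nat \<Rightarrow> nat \<Rightarrow> nat list \<Rightarrow> (var, int) mfps" where
  "Qpow n i l = (\<Prod>j=1..n. mfps_var (i, j) ^ (l ! (j - 1)))"

text \<open>
  The infinite sum over all multipartitions, taken coefficientwise. The \<open>Q\<^sup>\<Lambda>\<close> are pairwise
  different monomials, so at most one \<open>\<Lambda>\<close> contributes to each coefficient.
\<close>

definition Hilb :: "nat \<Rightarrow> nat \<Rightarrow> (nat \<Rightarrow> nat \<Rightarrow> nat) set \<Rightarrow> (var, int) mfps" where
  "Hilb n k G = Abs_mfps (\<lambda>m.
     \<Sum>\<Lambda> | \<Lambda> \<in> multipartitions n k \<and> mfps_coeff (\<Prod>i=1..k. Qpow n i (\<Lambda> i)) m \<noteq> 0.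
       int (cpoly.dim (graded_part n k G \<Lambda>)) * mfps_coeff (\<Prod>i=1..k. Qpow n i (\<Lambda> i)) m)"


section \<open>Descents\<close>

definition Des :: "nat \<Rightarrow> (nat \<Rightarrow> nat) \<Rightarrow> nat set" where
  "Des n \<sigma> = {i \<in> {1..n-1}. \<sigma> i > \<sigma> (i + 1)}"

definition des_partition :: "nat \<Rightarrow> (nat \<Rightarrow> nat) \<Rightarrow> nat list" where
  "des_partition n \<sigma> = map (\<lambda>i. card (Des n \<sigma> \<inter> {i..n})) [1..<Suc n]"

definition W :: "nat \<Rightarrow> nat \<Rightarrow> (nat \<Rightarrow> nat \<Rightarrow> nat) set" where
  "W n k = {\<sigma> \<in> Sym_pow n k. foldr (\<circ>) (map \<sigma> [1..<Suc k]) id = id}"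

end

theory Submission
  imports Defs "HOL-Library.List_Lexorder"
begin

text \<open>
  The invariants of a given multipartition degree have the orbit sums of monomials as a basis.
  For \<open>S\<^sub>n\<^sup>k\<close> there is one orbit in each degree; for \<open>\<Delta>S\<^sub>n\<close> the orbits are the multisets of
  columns of the \<open>k \<times> n\<close> exponent matrices. Since
  \<open>\<lambda>(\<sigma>)\<^sub>j - \<lambda>(\<sigma>)\<^bsub>j+1\<^esub> = [j \<in> Des \<sigma>]\<close>, the theorem says that the number of orbits of degree
  \<open>(\<lambda>\<^sup>1, \<dots>, \<lambda>\<^sup>k)\<close> is the number of \<open>(\<sigma>\<^sub>1, \<dots>, \<sigma>\<^sub>k) \<in> W\<close> such that every descent of
  \<open>\<sigma>\<^sub>i\<close> is a strict descent of \<open>\<lambda>\<^sup>i\<close>.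

  To such a tuple associate the matrix with rows \<open>\<lambda>\<^sup>i \<circ> (\<sigma>\<^sub>1 \<cdots> \<sigma>\<^sub>i)\<inverse>\<close>. The descent condition
  means exactly that \<open>\<sigma>\<^sub>1 \<cdots> \<sigma>\<^sub>i\<close> lists the columns after sorting them stably by row 1, then by
  row 2, and so on up to row \<open>i\<close>. Hence \<open>\<sigma>\<^sub>1 \<cdots> \<sigma>\<^sub>k = 1\<close> means that the columns are already sorted
  lexicographically with respect to the rows \<open>k, \<dots>, 1\<close>, and each orbit contains exactly one
  matrix of this kind.
\<close>

section \<open>Monomials and units among the power series\<close>

definition mfps_monom :: "('v \<Rightarrow>\<^sub>0 nat) \<Rightarrow> ('v, 'a::comm_ring_1) mfps" where
  "mfps_monom e = Abs_mfps (\<lambda>m. if m = e then 1 else 0)"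

lemma coeff_mfps_monom: "mfps_coeff (mfps_monom e) m = (if m = e then 1 else 0)"
  by (simp add: mfps_monom_def)

text \<open>By cancellation the index set has at most one element. The sum thus also covers the case
  in which \<open>e\<close> does not divide \<open>m\<close>.\<close>

lemma mfps_coeff_mult_monom:
  "mfps_coeff (f * mfps_monom e) m = (\<Sum>a | a + e = m. mfps_coeff f a)"
proof -
  have "mfps_coeff (f * mfps_monom e) m =
      (\<Sum>p\<in>splits m. if snd p = e then mfps_coeff f (fst p) else 0)"
    by (auto simp: times_mfps_def coeff_mfps_monom intro!: sum.cong)
  also have "\<dots> = (\<Sum>p\<in>{p \<in> splits m. snd p = e}. mfps_coeff f (fst p))"
    by (simp add: sum.inter_filter)
  also have "\<dots> = (\<Sum>a | a + e = m. mfps_coeff f a)"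
    by (rule sum.reindex_bij_witness[where i = "\<lambda>a. (a, e)" and j = fst])
      (auto simp: splits_def)
  finally show ?thesis .
qed

lemma mfps_monom_mult: "mfps_monom a * mfps_monom b = mfps_monom (a + b)"
proof (rule mfps_eqI)
  fix m
  have "{c. c + b = m} = (if \<exists>c. c + b = m then {m - b} else {})"
    by auto
  then show "mfps_coeff (mfps_monom a * mfps_monom b) m = mfps_coeff (mfps_monom (a + b)) m"
    by (auto simp: mfps_coeff_mult_monom coeff_mfps_monom)
qed

lemma mfps_monom_0: "mfps_monom 0 = 1"
  by (simp add: mfps_monom_def one_mfps_def)

lemma mfps_var_eq: "mfps_var v = mfps_monom (Poly_Mapping.single v 1)"
  by (simp add: mfps_var_def mfps_monom_def)

lemma mfps_var_power: "mfps_var v ^ p = mfps_monom (Poly_Mapping.single v p)"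
proof (induction p)
  case (Suc p)
  then show ?case
    by (simp add: mfps_var_eq mfps_monom_mult flip: single_add)
qed (simp add: mfps_monom_0)

lemma prod_mfps_monom: "(\<Prod>x\<in>A. mfps_monom (e x)) = mfps_monom (\<Sum>x\<in>A. e x)"
  by (induction A rule: infinite_finite_induct) (simp_all add: mfps_monom_0 mfps_monom_mult)

section \<open>Total degree and invertibility\<close>

definition pm_degree :: "('v \<Rightarrow>\<^sub>0 nat) \<Rightarrow> nat" where
  "pm_degree m = (\<Sum>v\<in>Poly_Mapping.keys m. Poly_Mapping.lookup m v)"

lemma pm_degree_superset:
  assumes "finite A" "Poly_Mapping.keys m \<subseteq> A"
  shows "pm_degree m = (\<Sum>v\<in>A. Poly_Mapping.lookup m v)"
  unfolding pm_degree_def using assms by (intro sum.mono_neutral_left) (auto simp: in_keys_iff)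

lemma pm_degree_add: "pm_degree (a + b) = pm_degree a + pm_degree b"
proof -
  let ?A = "Poly_Mapping.keys a \<union> Poly_Mapping.keys b"
  have "Poly_Mapping.keys (a + b) \<subseteq> ?A"
    by (rule Poly_Mapping.keys_add)
  then show ?thesis
    by (simp add: pm_degree_superset[of ?A] lookup_add sum.distrib)
qed

lemma pm_degree_eq_0: "pm_degree m = 0 \<Longrightarrow> m = 0"
  by (rule poly_mapping_eqI) (auto simp: pm_degree_def in_keys_iff)

text \<open>Each factor \<open>h\<close> uses up degree at least one: its constant coefficient
  vanishes, and any other split leaves a cofactor of smaller degree for the induction.\<close>

lemma coeff_power_eq_0:
  assumes "mfps_coeff h 0 = 0" "pm_degree m < d"
  shows "mfps_coeff (h ^ d) m = 0"
  using assms(2)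
proof (induction d arbitrary: m)
  case (Suc d)
  have "mfps_coeff h (fst p) * mfps_coeff (h ^ d) (snd p) = 0" if "p \<in> splits m" for p
  proof (cases "fst p = 0")
    case False
    then have "pm_degree (fst p) > 0"
      using pm_degree_eq_0 by blast
    then have "pm_degree (snd p) < d"
      using that Suc.prems by (auto simp: splits_def pm_degree_add)
    then show ?thesis by (simp add: Suc.IH)
  qed (simp add: assms(1))
  then show ?case
    by (auto simp: times_mfps_def intro!: sum.neutral)
qed simp

lemma mfps_coeff_sum: "mfps_coeff (\<Sum>x\<in>A. f x) m = (\<Sum>x\<in>A. mfps_coeff (f x) m)"
  by (induction A rule: infinite_finite_induct) (simp_all add: zero_mfps_def plus_mfps_def)

text \<open>The inverse is the geometric series in \<open>1 - f\<close>, which is finite in each coefficient.\<close>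

lemma mfps_is_unit:
  fixes f :: "('v, 'a::comm_ring_1) mfps"
  assumes "mfps_coeff f 0 = 1"
  shows "\<exists>g. f * g = 1"
proof -
  define h where "h = 1 - f"
  have h0: "mfps_coeff h 0 = 0"
    using assms by (simp add: h_def minus_mfps_def one_mfps_def)
  define g :: "('v, 'a) mfps" where "g = Abs_mfps (\<lambda>m. mfps_coeff (\<Sum>d\<le>pm_degree m. h ^ d) m)"
  \<comment> \<open>Powers beyond the degree of \<open>a\<close> vanish there, so every longer
    truncation gives the same coefficient. One bound can thus serve for all factors of a
    monomial.\<close>
  have g: "mfps_coeff g a = mfps_coeff (\<Sum>d\<le>N. h ^ d) a" if "pm_degree a \<le> N" for a N
    unfolding g_def mfps_coeff_Abs mfps_coeff_sum
    using that by (intro sum.mono_neutral_left) (auto simp: coeff_power_eq_0[OF h0])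
  have "f * g = 1"
  proof (rule mfps_eqI)
    fix m :: "'v \<Rightarrow>\<^sub>0 nat"
    let ?N = "pm_degree m"
    have "mfps_coeff (f * g) m = mfps_coeff (f * (\<Sum>d\<le>?N. h ^ d)) m"
      unfolding times_mfps_def mfps_coeff_Abs
      by (intro sum.cong refl) (auto simp: splits_def pm_degree_add intro!: g arg_cong2[of _ _ _ _ "(*)"])
    also have "f * (\<Sum>d\<le>?N. h ^ d) = 1 - h ^ Suc ?N"
      using sum_gp_basic[of h ?N] by (simp add: h_def)
    also have "mfps_coeff \<dots> m = mfps_coeff 1 m"
      by (simp add: minus_mfps_def coeff_power_eq_0[OF h0] del: power_Suc)
    finally show "mfps_coeff (f * g) m = mfps_coeff 1 m" .
  qed
  then show ?thesis ..
qed

section \<open>Dimensions of the graded parts\<close>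

definition mk_monom :: "nat \<Rightarrow> nat \<Rightarrow> (nat \<Rightarrow> nat \<Rightarrow> nat) \<Rightarrow> monom" where
  "mk_monom n k f = (\<Sum>i=1..k. \<Sum>j=1..n. Poly_Mapping.single (i, j) (f i j))"

lemma lookup_mk_monom:
  "Poly_Mapping.lookup (mk_monom n k f) (i, j) = (if i \<in> {1..k} \<and> j \<in> {1..n} then f i j else 0)"
proof -
  have "Poly_Mapping.lookup (mk_monom n k f) (i, j) =
      (\<Sum>i'=1..k. \<Sum>j'=1..n. if i' = i then if j' = j then f i j else 0 else 0)"
    by (auto simp: mk_monom_def lookup_sum lookup_single when_def intro!: sum.cong)
  also have "\<dots> = (\<Sum>i'=1..k. if i' = i then (\<Sum>j'=1..n. if j' = j then f i j else 0) else 0)"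
    by (rule sum.cong) simp_all
  finally show ?thesis by simp
qed

lemma mk_monom_in_monoms: "mk_monom n k f \<in> monoms n k"
  by (auto simp: monoms_def in_keys_iff lookup_mk_monom split: if_splits)

lemma lookup_monoms_outside:
  "M \<in> monoms n k \<Longrightarrow> \<not> (i \<in> {1..k} \<and> j \<in> {1..n}) \<Longrightarrow> Poly_Mapping.lookup M (i, j) = 0"
  by (auto simp: monoms_def in_keys_iff)

lemma monoms_eqI:
  assumes "M \<in> monoms n k" "M' \<in> monoms n k"
    and "\<And>i j. i \<in> {1..k} \<Longrightarrow> j \<in> {1..n} \<Longrightarrow>
      Poly_Mapping.lookup M (i, j) = Poly_Mapping.lookup M' (i, j)"
  shows "M = M'"
proof (rule poly_mapping_eqI)
  fix v :: var
  obtain i j where [simp]: "v = (i, j)" by (cases v)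
  show "Poly_Mapping.lookup M v = Poly_Mapping.lookup M' v"
    using assms lookup_monoms_outside[OF assms(1), of i j] lookup_monoms_outside[OF assms(2), of i j]
    by (cases "i \<in> {1..k} \<and> j \<in> {1..n}") auto
qed

lemma mk_monom_lookup:
  "M \<in> monoms n k \<Longrightarrow> mk_monom n k (\<lambda>i j. Poly_Mapping.lookup M (i, j)) = M"
  by (rule monoms_eqI[of _ n k]) (simp_all add: mk_monom_in_monoms lookup_mk_monom)

lemma mk_monom_cong:
  "(\<And>i j. i \<in> {1..k} \<Longrightarrow> j \<in> {1..n} \<Longrightarrow> f i j = g i j) \<Longrightarrow> mk_monom n k f = mk_monom n k g"
  unfolding mk_monom_def by (intro sum.cong) auto

lemma mk_monom_add: "mk_monom n k f + mk_monom n k g = mk_monom n k (\<lambda>i j. f i j + g i j)"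
  by (simp add: mk_monom_def sum.distrib single_add)

lemma prod_Qpow: "(\<Prod>i=1..k. Qpow n i (L i)) = mfps_monom (mk_monom n k (\<lambda>i j. L i ! (j - 1)))"
  by (simp add: Qpow_def mfps_var_power prod_mfps_monom mk_monom_def)

section \<open>The permutation action on monomials\<close>

lemma Sym_pow_permutes: "\<sigma> \<in> Sym_pow n k \<Longrightarrow> i \<in> {1..k} \<Longrightarrow> \<sigma> i permutes {1..n}"
  by (auto simp: Sym_pow_def Sym_def)

text \<open>Evaluating at \<open>\<sigma> i j\<close> avoids inverses. Injectivity of
  \<open>\<sigma> i\<close> leaves a single summand.\<close>

lemma lookup_act_monom:
  assumes \<sigma>: "\<sigma> \<in> Sym_pow n k" and M: "M \<in> monoms n k" and i: "i \<in> {1..k}"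
  shows "Poly_Mapping.lookup (act_monom \<sigma> M) (i, \<sigma> i j) = Poly_Mapping.lookup M (i, j)"
proof -
  have inj: "\<sigma> i j' = \<sigma> i j \<longleftrightarrow> j' = j" for j'
    using permutes_inj[OF Sym_pow_permutes[OF \<sigma> i]] by (auto dest: injD)
  have "Poly_Mapping.lookup (act_monom \<sigma> M) (i, \<sigma> i j) =
      (\<Sum>v\<in>Poly_Mapping.keys M. if v = (i, j) then Poly_Mapping.lookup M (i, j) else 0)"
    unfolding act_monom_def lookup_sum
    by (intro sum.cong refl) (force simp: lookup_single when_def inj)
  also have "\<dots> = Poly_Mapping.lookup M (i, j)"
    by (simp add: in_keys_iff)
  finally show ?thesis .
qed

lemma act_monom_in_monoms:
  assumes \<sigma>: "\<sigma> \<in> Sym_pow n k" and M: "M \<in> monoms n k"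
  shows "act_monom \<sigma> M \<in> monoms n k"
proof -
  have "Poly_Mapping.keys (act_monom \<sigma> M) \<subseteq>
      (\<Union>v\<in>Poly_Mapping.keys M. Poly_Mapping.keys (Poly_Mapping.single (fst v, \<sigma> (fst v) (snd v)) (Poly_Mapping.lookup M v)))"
    unfolding act_monom_def case_prod_beta prod.collapse by (rule Poly_Mapping.keys_sum)
  also have "\<dots> \<subseteq> {1..k} \<times> {1..n}"
  proof (intro UN_least)
    fix v assume v: "v \<in> Poly_Mapping.keys M"
    then have *: "fst v \<in> {1..k}" "snd v \<in> {1..n}" using M by (auto simp: monoms_def)
    then have "\<sigma> (fst v) (snd v) \<in> {1..n}"
      using permutes_in_image[OF Sym_pow_permutes[OF \<sigma> *(1)]] by blast
    then show "Poly_Mapping.keys (Poly_Mapping.single (fst v, \<sigma> (fst v) (snd v)) (Poly_Mapping.lookup M v)) \<subseteq> {1..k} \<times> {1..n}"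
      using * by auto
  qed
  finally show ?thesis by (simp add: monoms_def)
qed

lemma act_monom_eq_iff:
  assumes \<sigma>: "\<sigma> \<in> Sym_pow n k" and M: "M \<in> monoms n k" and N: "N \<in> monoms n k"
  shows "act_monom \<sigma> M = N \<longleftrightarrow> (\<forall>i\<in>{1..k}. \<forall>j\<in>{1..n}.
    Poly_Mapping.lookup N (i, \<sigma> i j) = Poly_Mapping.lookup M (i, j))" (is "_ \<longleftrightarrow> ?R")
proof
  assume "act_monom \<sigma> M = N"
  then show ?R using lookup_act_monom[OF \<sigma> M] by auto
next
  assume R: ?R
  show "act_monom \<sigma> M = N"
  proof (rule monoms_eqI[OF act_monom_in_monoms[OF \<sigma> M] N])
    fix i j assume i: "i \<in> {1..k}" and j: "j \<in> {1..n}"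
    from Sym_pow_permutes[OF \<sigma> i] j obtain j' where "j' \<in> {1..n}" "j = \<sigma> i j'"
      by (metis permutes_image imageE)
    then show "Poly_Mapping.lookup (act_monom \<sigma> M) (i, j) = Poly_Mapping.lookup N (i, j)"
      using lookup_act_monom[OF \<sigma> M i] R i by auto
  qed
qed

lemma inj_on_act_monom:
  assumes "\<sigma> \<in> Sym_pow n k"
  shows "inj_on (act_monom \<sigma>) (monoms n k)"
proof (rule inj_onI)
  fix M N assume MN: "M \<in> monoms n k" "N \<in> monoms n k" "act_monom \<sigma> M = act_monom \<sigma> N"
  show "M = N"
    by (rule monoms_eqI[OF MN(1,2)]) (metis lookup_act_monom assms MN)
qed

definition row :: "nat \<Rightarrow> monom \<Rightarrow> nat \<Rightarrow> nat multiset" where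
  "row n M i = image_mset (\<lambda>j. Poly_Mapping.lookup M (i, j)) (mset_set {1..n})"

lemma mset_set_atLeastAtMost: "mset_set {1..n} = mset [1..<Suc n]"
  by (metis atLeastLessThanSuc_atLeastAtMost mset_upt)

lemma rev_sort_eq_iff: "rev (sort xs) = rev (sort ys) \<longleftrightarrow> mset xs = mset (ys :: nat list)"
  by (metis mset_sort rev_is_rev_conv properties_for_sort sorted_sort)

text \<open>Sorted lists agree exactly when their multisets do, and outside \<open>{1..k}\<close>
  both multidegrees take the same default value.\<close>

lemma multidegree_eq_iff:
  "multidegree n k M = multidegree n k N \<longleftrightarrow> (\<forall>i\<in>{1..k}. row n M i = row n N i)"
proof -
  have r: "row n M i = mset (map (\<lambda>j. Poly_Mapping.lookup M (i, j)) [1..<Suc n])" for M i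
    unfolding row_def mset_set_atLeastAtMost by (simp only: mset_map)
  show ?thesis
    unfolding multidegree_def r rev_sort_eq_iff[symmetric]
    by (auto simp only: restrict_def fun_eq_iff split: if_splits)
qed

lemma multidegree_act_monom:
  assumes \<sigma>: "\<sigma> \<in> Sym_pow n k" and M: "M \<in> monoms n k"
  shows "multidegree n k (act_monom \<sigma> M) = multidegree n k M"
  unfolding multidegree_eq_iff
proof
  fix i assume i: "i \<in> {1..k}"
  \<comment> \<open>The index multiset is replaced by its image under \<open>\<sigma> i\<close>, so
    that the exponents are evaluated at the points \<open>\<sigma> i j\<close>.\<close>
  have "row n (act_monom \<sigma> M) i =
      image_mset (\<lambda>j. Poly_Mapping.lookup (act_monom \<sigma> M) (i, j)) (image_mset (\<sigma> i) (mset_set {1..n}))"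
    using Sym_pow_permutes[OF \<sigma> i] by (simp add: row_def permutes_image_mset)
  then show "row n (act_monom \<sigma> M) i = row n M i"
    using lookup_act_monom[OF \<sigma> M i] by (simp add: row_def multiset.map_comp o_def)
qed

definition degree_monoms :: "nat \<Rightarrow> nat \<Rightarrow> (nat \<Rightarrow> nat list) \<Rightarrow> monom set" where
  "degree_monoms n k \<Lambda> = {M \<in> monoms n k. multidegree n k M = \<Lambda>}"

text \<open>Every exponent in row \<open>i\<close> is an entry of \<open>\<Lambda> i\<close>, which
  leaves finitely many matrices.\<close>

lemma finite_degree_monoms: "finite (degree_monoms n k \<Lambda>)"
proof (rule finite_subset)
  let ?F = "\<Pi>\<^sub>E v\<in>{1..k} \<times> {1..n}. set (\<Lambda> (fst v))"
  show "degree_monoms n k \<Lambda> \<subseteq> (\<lambda>f. mk_monom n k (\<lambda>i j. f (i, j))) ` ?F"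
  proof
    fix M assume M: "M \<in> degree_monoms n k \<Lambda>"
    let ?f = "restrict (Poly_Mapping.lookup M) ({1..k} \<times> {1..n})"
    have "M = mk_monom n k (\<lambda>i j. Poly_Mapping.lookup M (i, j))"
      using M by (simp add: degree_monoms_def mk_monom_lookup)
    also have "\<dots> = mk_monom n k (\<lambda>i j. ?f (i, j))"
      by (rule mk_monom_cong) simp
    finally have "M = (\<lambda>f. mk_monom n k (\<lambda>i j. f (i, j))) ?f" .
    moreover have "?f \<in> ?F"
      using M by (auto simp: degree_monoms_def multidegree_def simp del: upt_Suc)
    ultimately show "M \<in> (\<lambda>f. mk_monom n k (\<lambda>i j. f (i, j))) ` ?F"
      by (rule image_eqI)
  qed
qed (auto intro!: finite_PiE)

section \<open>Invariants described by their coefficients\<close>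

lemma lookup_cscale: "Poly_Mapping.lookup (cscale c P) M = c * Poly_Mapping.lookup P M"
proof -
  have "cscale c P = Poly_Mapping.map ((*) c) P"
    by (simp add: cscale_def mult_map_scale_conv_mult)
  then show ?thesis by (simp add: Poly_Mapping.map.rep_eq when_def)
qed

lemma span_monomials:
  assumes "finite X"
  shows "cpoly.span {Poly_Mapping.single M 1 |M. M \<in> X} = {P. Poly_Mapping.keys P \<subseteq> X}"
proof (intro equalityI subsetI)
  fix P assume "P \<in> cpoly.span {Poly_Mapping.single M 1 |M. M \<in> X}"
  then show "P \<in> {P. Poly_Mapping.keys P \<subseteq> X}"
  proof (induction rule: cpoly.span_induct_alt)
    case (step c x y)
    then show ?case
      by (auto simp: in_keys_iff lookup_add lookup_cscale lookup_single when_def subset_iff split: if_splits)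
  qed simp
next
  fix P :: cpoly assume P: "P \<in> {P. Poly_Mapping.keys P \<subseteq> X}"
  have "P = (\<Sum>M\<in>X. cscale (Poly_Mapping.lookup P M) (Poly_Mapping.single M 1))"
  proof (rule poly_mapping_eqI)
    fix N
    have "(\<Sum>M\<in>X. Poly_Mapping.lookup P M * Poly_Mapping.lookup (Poly_Mapping.single M (1::complex)) N) =
        (\<Sum>M\<in>X. if M = N then Poly_Mapping.lookup P N else 0)"
      by (intro sum.cong) (auto simp: lookup_single when_def)
    then show "Poly_Mapping.lookup P N =
        Poly_Mapping.lookup (\<Sum>M\<in>X. cscale (Poly_Mapping.lookup P M) (Poly_Mapping.single M 1)) N"
      using P assms by (auto simp: lookup_sum lookup_cscale in_keys_iff)
  qed
  also have "\<dots> \<in> cpoly.span {Poly_Mapping.single M 1 |M. M \<in> X}"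
    by (intro cpoly.span_sum cpoly.span_scale cpoly.span_base) auto
  finally show "P \<in> cpoly.span {Poly_Mapping.single M 1 |M. M \<in> X}" .
qed

text \<open>The action is injective on monomials, so no two terms of \<open>P\<close> are
  merged.\<close>

lemma lookup_act_poly:
  assumes \<sigma>: "\<sigma> \<in> Sym_pow n k" and P: "Poly_Mapping.keys P \<subseteq> monoms n k" and M: "M \<in> monoms n k"
  shows "Poly_Mapping.lookup (act_poly \<sigma> P) (act_monom \<sigma> M) = Poly_Mapping.lookup P M"
proof -
  have "Poly_Mapping.lookup (act_poly \<sigma> P) (act_monom \<sigma> M) =
      (\<Sum>N\<in>Poly_Mapping.keys P. if N = M then Poly_Mapping.lookup P M else 0)"
    unfolding act_poly_def lookup_sum
    using P M inj_onD[OF inj_on_act_monom[OF \<sigma>]]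
    by (intro sum.cong refl) (auto simp: lookup_single when_def)
  then show ?thesis by (simp add: in_keys_iff)
qed

lemma bij_betw_act_monom:
  assumes "\<sigma> \<in> Sym_pow n k"
  shows "bij_betw (act_monom \<sigma>) (degree_monoms n k \<Lambda>) (degree_monoms n k \<Lambda>)"
proof -
  have "inj_on (act_monom \<sigma>) (degree_monoms n k \<Lambda>)"
    by (rule inj_on_subset[OF inj_on_act_monom[OF assms]]) (auto simp: degree_monoms_def)
  moreover have "act_monom \<sigma> ` degree_monoms n k \<Lambda> \<subseteq> degree_monoms n k \<Lambda>"
    using assms by (auto simp: degree_monoms_def act_monom_in_monoms multidegree_act_monom)
  ultimately show ?thesis
    by (simp add: bij_betw_def endo_inj_surj finite_degree_monoms)
qed

text \<open>Every monomial of this degree is an image under the action, so its coefficient is tested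
  by the right-hand side. All other coefficients vanish both in \<open>P\<close> and in
  \<open>act_poly \<sigma> P\<close>.\<close>

lemma act_poly_fixed_iff:
  assumes \<sigma>: "\<sigma> \<in> Sym_pow n k" and P: "Poly_Mapping.keys P \<subseteq> degree_monoms n k \<Lambda>"
  shows "act_poly \<sigma> P = P \<longleftrightarrow>
    (\<forall>M\<in>degree_monoms n k \<Lambda>. Poly_Mapping.lookup P (act_monom \<sigma> M) = Poly_Mapping.lookup P M)"
    (is "_ \<longleftrightarrow> ?R")
proof -
  have P': "Poly_Mapping.keys P \<subseteq> monoms n k" and X: "degree_monoms n k \<Lambda> \<subseteq> monoms n k"
    using P by (auto simp: degree_monoms_def)
  show ?thesis
  proof
    assume "act_poly \<sigma> P = P"
    then show ?R using lookup_act_poly[OF \<sigma> P'] X by auto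
  next
    assume R: ?R
    show "act_poly \<sigma> P = P"
    proof (rule poly_mapping_eqI)
      fix N
      show "Poly_Mapping.lookup (act_poly \<sigma> P) N = Poly_Mapping.lookup P N"
      proof (cases "N \<in> degree_monoms n k \<Lambda>")
        case True
        then obtain M where "M \<in> degree_monoms n k \<Lambda>" "N = act_monom \<sigma> M"
          using bij_betw_act_monom[OF \<sigma>] by (metis bij_betw_imp_surj_on imageE)
        then show ?thesis using R X lookup_act_poly[OF \<sigma> P'] by auto
      next
        case False
        have "act_monom \<sigma> M \<noteq> N" if "M \<in> Poly_Mapping.keys P" for M
          using that P False bij_betw_apply[OF bij_betw_act_monom[OF \<sigma>]] by blast
        then have "Poly_Mapping.lookup (act_poly \<sigma> P) N = 0"
          unfolding act_poly_def lookup_sum by (intro sum.neutral) (auto simp: lookup_single when_def)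
        moreover have "Poly_Mapping.lookup P N = 0"
          using False P by (auto simp: in_keys_iff)
        ultimately show ?thesis by simp
      qed
    qed
  qed
qed

text \<open>The sums over the fibres of a complete orbit invariant \<open>c\<close> form a basis.\<close>

lemma dim_graded_part:
  fixes c :: "monom \<Rightarrow> 'c"
  assumes G: "G \<subseteq> Sym_pow n k"
    and c: "\<And>M N. M \<in> degree_monoms n k \<Lambda> \<Longrightarrow> N \<in> degree_monoms n k \<Lambda> \<Longrightarrow>
      c M = c N \<longleftrightarrow> (\<exists>\<sigma>\<in>G. act_monom \<sigma> M = N)"
  shows "cpoly.dim (graded_part n k G \<Lambda>) = card (c ` degree_monoms n k \<Lambda>)"
proof -
  let ?X = "degree_monoms n k \<Lambda>"
  note [simp] = finite_degree_monoms
  have act: "act_monom \<sigma> M \<in> ?X" if "\<sigma> \<in> G" "M \<in> ?X" for \<sigma> M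
    using that G bij_betw_apply[OF bij_betw_act_monom] by blast
  \<comment> \<open>The fibres of \<open>c\<close> on this degree are the orbits, so invariance
    means that coefficients are constant on fibres.\<close>
  have gp: "graded_part n k G \<Lambda> = {P. Poly_Mapping.keys P \<subseteq> ?X \<and>
      (\<forall>M\<in>?X. \<forall>N\<in>?X. c M = c N \<longrightarrow> Poly_Mapping.lookup P M = Poly_Mapping.lookup P N)}"
  proof -
    have "graded_part n k G \<Lambda> = {P. Poly_Mapping.keys P \<subseteq> ?X \<and> (\<forall>\<sigma>\<in>G. act_poly \<sigma> P = P)}"
      using span_monomials[OF finite_degree_monoms, of n k \<Lambda>]
      by (auto simp: graded_part_def invariants_def poly_ring_def degree_monoms_def)
    also have "\<dots> = {P. Poly_Mapping.keys P \<subseteq> ?X \<and>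
        (\<forall>\<sigma>\<in>G. \<forall>M\<in>?X. Poly_Mapping.lookup P (act_monom \<sigma> M) = Poly_Mapping.lookup P M)}"
      using G act_poly_fixed_iff by blast
    also have "\<dots> = {P. Poly_Mapping.keys P \<subseteq> ?X \<and>
      (\<forall>M\<in>?X. \<forall>N\<in>?X. c M = c N \<longrightarrow> Poly_Mapping.lookup P M = Poly_Mapping.lookup P N)}"
      using c act by (intro Collect_cong conj_cong refl) metis
    finally show ?thesis .
  qed
  define b where "b t = (\<Sum>M | M \<in> ?X \<and> c M = t. Poly_Mapping.single M (1::complex))" for t
  have lb: "Poly_Mapping.lookup (b t) M = (if M \<in> ?X \<and> c M = t then 1 else 0)" for t M
    by (auto simp: b_def lookup_sum lookup_single when_def)
  have lbsum: "Poly_Mapping.lookup (\<Sum>t\<in>c ` ?X. cscale (u t) (b t)) M = (if M \<in> ?X then u (c M) else 0)"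
    for u M
  proof -
    have "Poly_Mapping.lookup (\<Sum>t\<in>c ` ?X. cscale (u t) (b t)) M =
        (\<Sum>t\<in>c ` ?X. if t = c M then if M \<in> ?X then u (c M) else 0 else 0)"
      unfolding lookup_sum lookup_cscale lb by (rule sum.cong) auto
    then show ?thesis by auto
  qed
  have inj: "inj_on b (c ` ?X)"
  proof (rule inj_onI)
    fix s t assume "s \<in> c ` ?X" and eq: "b s = b t"
    then obtain M where M: "M \<in> ?X" "s = c M" by auto
    then show "s = t" using lb[of s M] lb[of t M] eq by (simp split: if_splits)
  qed
  show ?thesis
  proof (rule cpoly.dim_unique)
    show "b ` c ` ?X \<subseteq> graded_part n k G \<Lambda>"
      by (auto simp: gp lb in_keys_iff split: if_splits)
    show "graded_part n k G \<Lambda> \<subseteq> cpoly.span (b ` c ` ?X)"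
    proof
      fix P assume P: "P \<in> graded_part n k G \<Lambda>"
      \<comment> \<open>The coefficient may be read off at any representative, since it is constant
        on fibres.\<close>
      define u where "u t = Poly_Mapping.lookup P (SOME M. M \<in> ?X \<and> c M = t)" for t
      have u: "u (c M) = Poly_Mapping.lookup P M" if "M \<in> ?X" for M
        using someI[of "\<lambda>N. N \<in> ?X \<and> c N = c M" M] that P unfolding u_def gp by blast
      have "Poly_Mapping.keys P \<subseteq> ?X"
        using P unfolding gp by blast
      then have "Poly_Mapping.lookup P M = 0" if "M \<notin> ?X" for M
        using that by (auto simp: in_keys_iff)
      then have "P = (\<Sum>t\<in>c ` ?X. cscale (u t) (b t))"
        by (intro poly_mapping_eqI) (simp add: lbsum u)
      also have "\<dots> \<in> cpoly.span (b ` c ` ?X)"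
        by (intro cpoly.span_sum cpoly.span_scale cpoly.span_base) auto
      finally show "P \<in> cpoly.span (b ` c ` ?X)" .
    qed
    show "cpoly.independent (b ` c ` ?X)"
    proof
      assume "cpoly.dependent (b ` c ` ?X)"
      then obtain u v where v: "v \<in> b ` c ` ?X" "u v \<noteq> 0"
        and sum: "(\<Sum>w\<in>b ` c ` ?X. cscale (u w) w) = 0"
        by (auto simp: cpoly.dependent_finite)
      from v obtain M where M: "M \<in> ?X" "v = b (c M)" by auto
      have "(\<Sum>t\<in>c ` ?X. cscale (u (b t)) (b t)) = 0"
        using sum by (simp add: sum.reindex[OF inj] o_def)
      \<comment> \<open>The coefficient at \<open>M\<close> sees only the fibre sum of
        \<open>c M\<close>, because distinct fibres are disjoint.\<close>
      then have "u (b (c M)) = 0"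
        using lbsum[of "\<lambda>t. u (b t)" M] M by simp
      then show False using v M by simp
    qed
    show "card (b ` c ` ?X) = card (c ` ?X)"
      by (rule card_image[OF inj])
  qed
qed

section \<open>Counting diagonal orbits\<close>

lemma permutes_mem: "p permutes A \<Longrightarrow> x \<in> A \<Longrightarrow> p x \<in> A"
  by (simp add: permutes_in_image)

definition antitone_upto :: "nat \<Rightarrow> (nat \<Rightarrow> nat) \<Rightarrow> bool" where
  "antitone_upto n g \<longleftrightarrow> (\<forall>j\<in>{1..<n}. g (Suc j) \<le> g j)"

lemma antitone_uptoD:
  assumes "antitone_upto n g" "1 \<le> a" "a \<le> b" "b \<le> n"
  shows "g b \<le> g a"
  using assms(3,4)
proof (induction b rule: dec_induct)
  case (step b)
  then have "g (Suc b) \<le> g b" using assms(1,2) by (simp add: antitone_upto_def)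
  then show ?case using step by simp
qed simp

text \<open>A weakly decreasing sequence is the sorted list of its values. The type is a general
  linear order because the lemma serves both for numbers and for lexicographically ordered
  columns.\<close>

lemma antitone_eqI:
  fixes g h :: "nat \<Rightarrow> 'a::linorder"
  assumes g: "\<And>a b. 1 \<le> a \<Longrightarrow> a \<le> b \<Longrightarrow> b \<le> n \<Longrightarrow> g b \<le> g a"
    and h: "\<And>a b. 1 \<le> a \<Longrightarrow> a \<le> b \<Longrightarrow> b \<le> n \<Longrightarrow> h b \<le> h a"
    and eq: "image_mset g (mset_set {1..n}) = image_mset h (mset_set {1..n})"
    and j: "j \<in> {1..n}"
  shows "g j = h j"
proof -
  have sorted: "sorted (rev (map f [1..<Suc n]))"
    if "\<And>a b. 1 \<le> a \<Longrightarrow> a \<le> b \<Longrightarrow> b \<le> n \<Longrightarrow> f b \<le> f a" for f :: "nat \<Rightarrow> 'a"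
    unfolding sorted_wrt_rev sorted_wrt_map
    by (rule sorted_wrt_mono_rel[OF _ sorted_wrt_upt]) (auto intro: that)
  have "mset (rev (map g [1..<Suc n])) = mset (rev (map h [1..<Suc n]))"
    using eq by (simp only: mset_rev mset_map mset_set_atLeastAtMost)
  then have "rev (map g [1..<Suc n]) = rev (map h [1..<Suc n])"
    using sorted[of g] sorted[of h] g h by (metis properties_for_sort)
  then have "map g [1..<Suc n] = map h [1..<Suc n]"
    by (simp only: rev_is_rev_conv)
  then show ?thesis using j by (simp del: upt_Suc)
qed

text \<open>Strict growth forces \<open>a \<le> p a\<close> by induction, and a permutation of
  \<open>{1..n}\<close> with this property is the identity.\<close>

lemma permutes_strict_mono_id:
  fixes p :: "nat \<Rightarrow> nat"
  assumes p: "p permutes {1..n}"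
    and mono: "\<And>a b. a \<in> {1..n} \<Longrightarrow> b \<in> {1..n} \<Longrightarrow> a < b \<Longrightarrow> p a < p b"
  shows "p = id"
proof -
  have "a \<le> p a" if "1 \<le> a" "a \<le> n" for a
    using that
  proof (induction a rule: dec_induct)
    case base
    then show ?case using permutes_in_image[OF p, of 1] by simp
  next
    case (step a)
    then show ?case using mono[of a "Suc a"] by simp
  qed
  then show ?thesis by (intro permutes_natset_ge[OF p]) auto
qed

text \<open>\<open>p \<circ> inv q\<close> is strictly increasing, hence the identity.\<close>

lemma permutes_order_unique:
  fixes p q :: "nat \<Rightarrow> nat"
  assumes p: "p permutes {1..n}" and q: "q permutes {1..n}"
    and iff: "\<And>a b. a \<in> {1..n} \<Longrightarrow> b \<in> {1..n} \<Longrightarrow> p a < p b \<longleftrightarrow> q a < q b"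
  shows "p = q"
proof -
  have "p \<circ> inv q = id"
  proof (rule permutes_strict_mono_id)
    show "p \<circ> inv q permutes {1..n}"
      by (rule permutes_compose[OF permutes_inv[OF q] p])
    fix a b assume ab: "a \<in> {1..n}" "b \<in> {1..n}" "a < b"
    from iff[OF ab(1,2)[THEN permutes_mem[OF permutes_inv[OF q]]]]
    show "(p \<circ> inv q) a < (p \<circ> inv q) b"
      using ab(3) permutes_inverses(1)[OF q] by simp
  qed
  then have "p (inv q (q x)) = q x" for x by (metis comp_apply id_apply)
  then show ?thesis using permutes_inverses(2)[OF q] by auto
qed

lemma ex_rank_permutation:
  fixes R :: "nat \<Rightarrow> nat \<Rightarrow> bool"
  assumes irrefl: "\<And>a. \<not> R a a"
    and trans: "\<And>a b c. R a b \<Longrightarrow> R b c \<Longrightarrow> R a c"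
    and total: "\<And>a b. a \<noteq> b \<Longrightarrow> R a b \<or> R b a"
  shows "\<exists>r. r permutes {1..n} \<and> (\<forall>a\<in>{1..n}. \<forall>b\<in>{1..n}. r a < r b \<longleftrightarrow> R a b)"
proof -
  \<comment> \<open>The rank counts predecessors; adding one makes it run over
    \<open>{1..n}\<close>.\<close>
  define r where "r a = (if a \<in> {1..n} then Suc (card {b \<in> {1..n}. R b a}) else a)" for a
  have mono: "r a < r b" if "a \<in> {1..n}" "b \<in> {1..n}" "R a b" for a b
  proof -
    have "{c \<in> {1..n}. R c a} \<subset> {c \<in> {1..n}. R c b}"
      using that irrefl trans by blast
    then show ?thesis using that by (simp add: r_def psubset_card_mono)
  qed
  have iff: "r a < r b \<longleftrightarrow> R a b" if "a \<in> {1..n}" "b \<in> {1..n}" for a b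
    using mono[OF that] mono[OF that(2,1)] total[of a b] by (metis less_asym less_irrefl)
  have "inj_on r {1..n}"
    by (rule inj_onI) (metis iff total less_irrefl)
  moreover have "r a \<in> {1..n}" if a: "a \<in> {1..n}" for a
  proof -
    have "card {b \<in> {1..n}. R b a} < card {1..n}"
      using a irrefl by (intro psubset_card_mono psubsetI) blast+
    then show ?thesis using a by (simp add: r_def)
  qed
  ultimately have "bij_betw r {1..n} {1..n}"
    by (simp add: bij_betw_def endo_inj_surj image_subset_iff)
  then have "r permutes {1..n}"
    by (rule bij_imp_permutes) (auto simp: r_def)
  with iff show ?thesis by blast
qed

section \<open>Stable sorting and descents\<close>

fun column :: "(nat \<Rightarrow> nat \<Rightarrow> nat) \<Rightarrow> nat \<Rightarrow> nat \<Rightarrow> nat list" where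
  "column f 0 a = []"
| "column f (Suc i) a = f (Suc i) a # column f i a"

lemma column_eq_iff: "column f k a = column g k b \<longleftrightarrow> (\<forall>i\<in>{1..k}. f i a = g i b)"
  by (induction k) (auto simp: atLeastAtMostSuc_conv)

text \<open>The order of the positions after sorting them stably by \<open>f 1\<close>, then by \<open>f 2\<close>, \ldots,
  then by \<open>f i\<close>, each time decreasingly.\<close>

definition before :: "(nat \<Rightarrow> nat \<Rightarrow> nat) \<Rightarrow> nat \<Rightarrow> nat \<Rightarrow> nat \<Rightarrow> bool" where
  "before f i a b \<longleftrightarrow> column f i b < column f i a \<or> column f i a = column f i b \<and> a < b"

lemma before_0: "before f 0 a b \<longleftrightarrow> a < b"
  by (simp add: before_def)

text \<open>The newest row heads the list \<open>column\<close>, so the lexicographic order lets it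
  decide first and leaves ties to the previous order, as a stable sort does.\<close>

lemma before_Suc:
  "before f (Suc i) a b \<longleftrightarrow>
    f (Suc i) b < f (Suc i) a \<or> f (Suc i) a = f (Suc i) b \<and> before f i a b"
  by (auto simp: before_def)

lemma before_cong:
  "(\<And>j. j \<in> {1..i} \<Longrightarrow> f j a = g j a) \<Longrightarrow> (\<And>j. j \<in> {1..i} \<Longrightarrow> f j b = g j b) \<Longrightarrow>
    before f i a b \<longleftrightarrow> before g i a b"
  by (induction i) (auto simp: before_0 before_Suc)

text \<open>Ties between equal columns are broken by the index, so \<open>before f i\<close> is a
  strict total order.\<close>

lemma ex_rank_before:
  "\<exists>r. r permutes {1..n} \<and> (\<forall>a\<in>{1..n}. \<forall>b\<in>{1..n}. r a < r b \<longleftrightarrow> before f i a b)"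
  by (rule ex_rank_permutation) (auto simp: before_def)

text \<open>In the application this sends a position after the first \<open>i\<close> sorts to the
  column standing there; the inverse gives the position of a column.\<close>

definition perm_prod :: "(nat \<Rightarrow> nat \<Rightarrow> nat) \<Rightarrow> nat \<Rightarrow> nat \<Rightarrow> nat" where
  "perm_prod \<sigma> i = foldr (\<circ>) (map \<sigma> [1..<Suc i]) id"

lemma perm_prod_0: "perm_prod \<sigma> 0 = id"
  by (simp add: perm_prod_def)

lemma foldr_comp: "foldr (\<circ>) ps q = foldr (\<circ>) ps id \<circ> q"
  by (induction ps) (simp_all add: comp_assoc)

lemma perm_prod_Suc: "perm_prod \<sigma> (Suc i) = perm_prod \<sigma> i \<circ> \<sigma> (Suc i)"
  using foldr_comp[of "map \<sigma> [1..<Suc i]" "\<sigma> (Suc i)"] by (simp add: perm_prod_def)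

lemma perm_prod_permutes:
  assumes "\<sigma> \<in> Sym_pow n k" "i \<le> k"
  shows "perm_prod \<sigma> i permutes {1..n}"
  using assms(2)
proof (induction i)
  case (Suc i)
  then show ?case
    unfolding perm_prod_Suc
    by (intro permutes_compose Sym_pow_permutes[OF assms(1)]) simp_all
qed (simp add: perm_prod_0 permutes_id)

text \<open>On a stretch where \<open>L\<close> is constant no descent of \<open>s\<close> is
  allowed, so \<open>s\<close> increases from each index to the next.\<close>

lemma block_increasing:
  assumes L: "antitone_upto n L" and D: "\<And>j. j \<in> Des n s \<Longrightarrow> L (Suc j) < L j"
    and inj: "inj s" and x: "1 \<le> x" and y: "Suc x \<le> y" "y \<le> n" "L x = L y"
  shows "s x < s y"
  using y
proof (induction y rule: dec_induct)
  case base
  then have "x \<notin> Des n s" using D[of x] by auto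
  moreover have "s x \<noteq> s (Suc x)" using injD[OF inj, of x "Suc x"] by auto
  ultimately show ?case using x base by (auto simp: Des_def)
next
  case (step y)
  have "L (Suc y) \<le> L y" "L y \<le> L x"
    using antitone_uptoD[OF L, of y "Suc y"] antitone_uptoD[OF L, of x y] step x by simp_all
  then have eq: "L x = L y" "L y = L (Suc y)" using step.prems by auto
  then have "y \<notin> Des n s" using D[of y] by auto
  moreover have "s y \<noteq> s (Suc y)" using injD[OF inj, of y "Suc y"] by auto
  ultimately have "s y < s (Suc y)" using x step by (auto simp: Des_def)
  then show ?case using step eq by simp
qed

text \<open>This is one stable sort by \<open>L\<close>: unequal values are ordered by monotonicity
  of \<open>L\<close>, equal ones by \<open>block_increasing\<close>.\<close>

lemma less_iff_block:
  assumes L: "antitone_upto n L" and D: "\<And>j. j \<in> Des n s \<Longrightarrow> L (Suc j) < L j"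
    and inj: "inj s" and x: "x \<in> {1..n}" and y: "y \<in> {1..n}"
  shows "x < y \<longleftrightarrow> L y < L x \<or> L x = L y \<and> s x < s y"
proof -
  have less: "L v < L u \<or> L u = L v \<and> s u < s v" if "u < v" "u \<in> {1..n}" "v \<in> {1..n}" for u v
    using that antitone_uptoD[OF L, of u v] block_increasing[OF L D inj, of u v]
    by (cases "L u = L v") auto
  \<comment> \<open>For the converse, \<open>y < x\<close> would give the opposite alternative, and
    the two exclude each other.\<close>
  show ?thesis
    using less[of x y] less[of y x] x y by (cases x y rule: linorder_cases) auto
qed

section \<open>Compatible tuples and column multisets\<close>

definition dominant_monoms :: "nat \<Rightarrow> nat \<Rightarrow> monom set" where
  "dominant_monoms n k =
    {m \<in> monoms n k. \<forall>i\<in>{1..k}. antitone_upto n (\<lambda>j. Poly_Mapping.lookup m (i, j))}"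

text \<open>For dominant \<open>m\<close>, these are the tuples whose descent exponent can be split
  off from \<open>m\<close> with a dominant remainder; see \<open>dominant_split\<close>.\<close>

definition W_compat :: "nat \<Rightarrow> nat \<Rightarrow> monom \<Rightarrow> (nat \<Rightarrow> nat \<Rightarrow> nat) set" where
  "W_compat n k m = {\<sigma> \<in> W n k. \<forall>i\<in>{1..k}. \<forall>j\<in>Des n (\<sigma> i).
    Poly_Mapping.lookup m (i, Suc j) < Poly_Mapping.lookup m (i, j)}"

text \<open>Row \<open>i\<close> of \<open>m\<close> is carried back from the positions after
  \<open>i\<close> sorts to the original columns.\<close>

definition spread :: "monom \<Rightarrow> (nat \<Rightarrow> nat \<Rightarrow> nat) \<Rightarrow> nat \<Rightarrow> nat \<Rightarrow> nat" where
  "spread m \<sigma> i a = Poly_Mapping.lookup m (i, inv (perm_prod \<sigma> i) a)"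

lemma W_Sym_pow: "\<sigma> \<in> W n k \<Longrightarrow> \<sigma> \<in> Sym_pow n k"
  by (simp add: W_def)

lemma W_perm_prod: "\<sigma> \<in> W n k \<longleftrightarrow> \<sigma> \<in> Sym_pow n k \<and> perm_prod \<sigma> k = id"
  by (simp add: W_def perm_prod_def)

lemma inv_perm_prod:
  assumes "\<sigma> \<in> Sym_pow n k" "Suc i \<le> k"
  shows "inv (perm_prod \<sigma> i) a = \<sigma> (Suc i) (inv (perm_prod \<sigma> (Suc i)) a)"
proof -
  have p: "perm_prod \<sigma> i permutes {1..n}" "perm_prod \<sigma> (Suc i) permutes {1..n}"
    by (rule perm_prod_permutes[OF assms(1)], use assms(2) in simp)+
  have "perm_prod \<sigma> i (\<sigma> (Suc i) (inv (perm_prod \<sigma> (Suc i)) a)) = a"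
    using permutes_inverses(1)[OF p(2), of a] by (simp add: perm_prod_Suc)
  then show ?thesis using permutes_inverses(2)[OF p(1)] by metis
qed

text \<open>The descent condition makes each new row a stable sort: \<open>less_iff_block\<close>
  compares the new positions, and \<open>\<sigma> (Suc i)\<close> takes ties back to the previous
  positions, which the induction hypothesis orders.\<close>

lemma rank_spread:
  assumes m: "m \<in> dominant_monoms n k" and \<sigma>: "\<sigma> \<in> W_compat n k m"
    and i: "i \<le> k" and a: "a \<in> {1..n}" and b: "b \<in> {1..n}"
  shows "inv (perm_prod \<sigma> i) a < inv (perm_prod \<sigma> i) b \<longleftrightarrow> before (spread m \<sigma>) i a b"
  using i
proof (induction i)
  case 0
  then show ?case by (simp add: perm_prod_0 before_0)
next
  case (Suc i)
  have \<sigma>': "\<sigma> \<in> Sym_pow n k" using \<sigma> by (simp add: W_compat_def W_Sym_pow)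
  let ?r = "inv (perm_prod \<sigma> (Suc i))"
  have "?r permutes {1..n}"
    by (rule permutes_inv[OF perm_prod_permutes[OF \<sigma>' Suc.prems]])
  note r = permutes_mem[OF this a] permutes_mem[OF this b]
  have "?r a < ?r b \<longleftrightarrow> spread m \<sigma> (Suc i) b < spread m \<sigma> (Suc i) a \<or>
      spread m \<sigma> (Suc i) a = spread m \<sigma> (Suc i) b \<and> \<sigma> (Suc i) (?r a) < \<sigma> (Suc i) (?r b)"
    unfolding spread_def
  proof (rule less_iff_block[OF _ _ _ r])
    show "antitone_upto n (\<lambda>j. Poly_Mapping.lookup m (Suc i, j))"
      using m Suc.prems by (simp add: dominant_monoms_def)
    show "Poly_Mapping.lookup m (Suc i, Suc j) < Poly_Mapping.lookup m (Suc i, j)"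
      if "j \<in> Des n (\<sigma> (Suc i))" for j
      using \<sigma> that Suc.prems by (auto simp: W_compat_def)
    show "inj (\<sigma> (Suc i))"
      using permutes_inj[OF Sym_pow_permutes[OF \<sigma>']] Suc.prems by simp
  qed
  then show ?case
    using Suc inv_perm_prod[OF \<sigma>' Suc.prems] by (simp add: before_Suc)
qed

text \<open>This is the complete invariant of diagonal orbits.\<close>

definition columns :: "nat \<Rightarrow> nat \<Rightarrow> monom \<Rightarrow> nat list multiset" where
  "columns n k M =
    image_mset (column (\<lambda>i j. Poly_Mapping.lookup M (i, j)) k) (mset_set {1..n})"

lemma columns_mk_monom: "columns n k (mk_monom n k f) = image_mset (column f k) (mset_set {1..n})"
  unfolding columns_def
  by (rule image_mset_cong) (auto simp: column_eq_iff lookup_mk_monom)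

lemma row_mk_monom: "i \<in> {1..k} \<Longrightarrow> row n (mk_monom n k f) i = image_mset (f i) (mset_set {1..n})"
  unfolding row_def by (rule image_mset_cong) (auto simp: lookup_mk_monom)

lemma image_mset_permutes:
  assumes "p permutes A"
  shows "image_mset (\<lambda>x. f (p x)) (mset_set A) = image_mset f (mset_set A)"
proof -
  have "image_mset (\<lambda>x. f (p x)) (mset_set A) = image_mset f (image_mset p (mset_set A))"
    by (simp add: multiset.map_comp o_def)
  then show ?thesis by (simp only: permutes_image_mset[OF assms])
qed

lemma spread_in_degree_monoms:
  assumes "\<sigma> \<in> W n k"
  shows "mk_monom n k (spread m \<sigma>) \<in> degree_monoms n k (multidegree n k m)"
proof -
  have "row n (mk_monom n k (spread m \<sigma>)) i = row n m i" if i: "i \<in> {1..k}" for i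
  proof -
    have "inv (perm_prod \<sigma> i) permutes {1..n}"
      by (rule permutes_inv[OF perm_prod_permutes[OF W_Sym_pow[OF assms]]]) (use i in simp)
    from image_mset_permutes[OF this, of "\<lambda>j. Poly_Mapping.lookup m (i, j)"]
    show ?thesis unfolding row_mk_monom[OF i] unfolding spread_def row_def .
  qed
  then show ?thesis
    by (simp add: degree_monoms_def mk_monom_in_monoms multidegree_eq_iff)
qed

text \<open>The full product is the identity, so the order after all \<open>k\<close> sorts is that
  of the indices.\<close>

lemma column_spread_antitone:
  assumes m: "m \<in> dominant_monoms n k" and \<sigma>: "\<sigma> \<in> W_compat n k m"
    and ab: "1 \<le> a" "a \<le> b" "b \<le> n"
  shows "column (spread m \<sigma>) k b \<le> column (spread m \<sigma>) k a"
proof (cases "a = b")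
  case False
  have "perm_prod \<sigma> k = id" using \<sigma> by (simp add: W_compat_def W_perm_prod)
  then have "before (spread m \<sigma>) k a b"
    using rank_spread[OF m \<sigma> order_refl, of a b] ab False by simp
  then show ?thesis by (auto simp: before_def)
qed simp

text \<open>The column multiset determines the decreasing sequence of columns, hence all entries of
  \<open>spread m \<sigma>\<close> in range. These fix every intermediate order, so every partial
  product and then every \<open>\<sigma> i\<close>.\<close>

lemma inj_on_columns_spread:
  assumes m: "m \<in> dominant_monoms n k"
  shows "inj_on (\<lambda>\<sigma>. columns n k (mk_monom n k (spread m \<sigma>))) (W_compat n k m)"
proof (rule inj_onI)
  fix \<sigma> \<tau> assume \<sigma>: "\<sigma> \<in> W_compat n k m" and \<tau>: "\<tau> \<in> W_compat n k m"
    and eq: "columns n k (mk_monom n k (spread m \<sigma>)) = columns n k (mk_monom n k (spread m \<tau>))"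
  have "column (spread m \<sigma>) k a = column (spread m \<tau>) k a" if "a \<in> {1..n}" for a
    using column_spread_antitone[OF m \<sigma>] column_spread_antitone[OF m \<tau>] eq that
    by (intro antitone_eqI[of n]) (auto simp: columns_mk_monom)
  then have sp: "spread m \<sigma> i a = spread m \<tau> i a" if "i \<in> {1..k}" "a \<in> {1..n}" for i a
    using that by (auto simp: column_eq_iff)
  have \<sigma>': "\<sigma> \<in> Sym_pow n k" and \<tau>': "\<tau> \<in> Sym_pow n k"
    using \<sigma> \<tau> by (simp_all add: W_compat_def W_Sym_pow)
  have r: "inv (perm_prod \<sigma> i) = inv (perm_prod \<tau> i)" if i: "i \<le> k" for i
  proof (rule permutes_order_unique)
    show "inv (perm_prod \<sigma> i) permutes {1..n}" "inv (perm_prod \<tau> i) permutes {1..n}"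
      by (rule permutes_inv[OF perm_prod_permutes[OF \<sigma>' i]])
        (rule permutes_inv[OF perm_prod_permutes[OF \<tau>' i]])
    fix a b assume ab: "a \<in> {1..n}" "b \<in> {1..n}"
    have "before (spread m \<sigma>) i a b \<longleftrightarrow> before (spread m \<tau>) i a b"
      by (rule before_cong) (use sp ab i in auto)
    then show "inv (perm_prod \<sigma> i) a < inv (perm_prod \<sigma> i) b \<longleftrightarrow>
        inv (perm_prod \<tau> i) a < inv (perm_prod \<tau> i) b"
      using rank_spread[OF m \<sigma> i ab] rank_spread[OF m \<tau> i ab] by simp
  qed
  have "\<sigma> i = \<tau> i" if i: "i \<in> {1..k}" for i
  proof
    fix x
    obtain j where j: "i = Suc j" using i by (cases i) auto
    have p: "perm_prod \<sigma> i permutes {1..n}" by (rule perm_prod_permutes[OF \<sigma>']) (use i in simp)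
    let ?a = "perm_prod \<sigma> i x"
    have x: "inv (perm_prod \<sigma> i) ?a = x" by (rule permutes_inverses(2)[OF p])
    \<comment> \<open>Each factor is recovered from two consecutive partial products.\<close>
    then show "\<sigma> i x = \<tau> i x"
      using inv_perm_prod[OF \<sigma>', of j ?a] inv_perm_prod[OF \<tau>', of j ?a] r[of i] r[of j] i j
      by auto
  qed
  moreover have "\<sigma> \<in> extensional {1..k}" "\<tau> \<in> extensional {1..k}"
    using \<sigma>' \<tau>' by (auto simp: Sym_pow_def PiE_def)
  ultimately show "\<sigma> = \<tau>" by (metis extensionalityI)
qed

text \<open>The columns of \<open>M\<close> are first put into decreasing order. The tuple then
  consists of the quotients between consecutive stable sorts of the resulting matrix.\<close>

lemma columns_spread_surj:
  assumes m: "m \<in> dominant_monoms n k" and M: "M \<in> degree_monoms n k (multidegree n k m)"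
  shows "\<exists>\<sigma>\<in>W_compat n k m. columns n k (mk_monom n k (spread m \<sigma>)) = columns n k M"
proof -
  define f where "f i j = Poly_Mapping.lookup M (i, j)" for i j
  obtain r where r: "r permutes {1..n}"
    and r_less: "\<And>a b. a \<in> {1..n} \<Longrightarrow> b \<in> {1..n} \<Longrightarrow> r a < r b \<longleftrightarrow> before f k a b"
    using ex_rank_before[of n f k] by blast
  \<comment> \<open>\<open>r\<close> gives each column its place in the full order, so
    \<open>g\<close> is the exponent matrix of \<open>M\<close> with its columns rearranged
    decreasingly.\<close>
  define g where "g i a = f i (inv r a)" for i a
  have inv_r: "inv r permutes {1..n}" by (rule permutes_inv[OF r])
  have col_g: "column g i a = column f i (inv r a)" for i a
    by (simp add: column_eq_iff g_def)
  have sorted: "before g k a b" if ab: "a \<in> {1..n}" "b \<in> {1..n}" "a < b" for a b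
  proof -
    have "inv r a \<in> {1..n}" "inv r b \<in> {1..n}"
      by (rule permutes_mem[OF inv_r ab(1)], rule permutes_mem[OF inv_r ab(2)])
    from r_less[OF this] have "before f k (inv r a) (inv r b)"
      using ab(3) by (simp add: permutes_inverses(1)[OF r])
    then show ?thesis using ab(3) by (auto simp: before_def col_g)
  qed
  obtain R where R: "\<And>i. R i permutes {1..n}"
    and R_less: "\<And>i a b. a \<in> {1..n} \<Longrightarrow> b \<in> {1..n} \<Longrightarrow> R i a < R i b \<longleftrightarrow> before g i a b"
    using ex_rank_before[of n g] by metis
  have R0: "R 0 = id"
    by (rule permutes_strict_mono_id[OF R]) (simp add: R_less before_0)
  \<comment> \<open>The columns of \<open>g\<close> are sorted already, so performing all the sorts
    moves nothing.\<close>
  have Rk: "R k = id"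
    by (rule permutes_strict_mono_id[OF R]) (simp add: R_less sorted)
  \<comment> \<open>The partial products of these quotients telescope to \<open>inv (R i)\<close>,
    starting from \<open>R 0 = id\<close>.\<close>
  define \<sigma> where "\<sigma> = (\<lambda>i\<in>{1..k}. R (i - 1) \<circ> inv (R i))"
  have \<sigma>: "\<sigma> \<in> Sym_pow n k"
    using permutes_compose[OF permutes_inv[OF R] R] by (auto simp: \<sigma>_def Sym_pow_def Sym_def)
  have pp: "perm_prod \<sigma> i = inv (R i)" if "i \<le> k" for i
    using that
  proof (induction i)
    case 0
    then show ?case by (simp add: perm_prod_0 R0)
  next
    case (Suc i)
    then show ?case
      using permutes_inverses(2)[OF R] by (auto simp: perm_prod_Suc \<sigma>_def fun_eq_iff)
  qed
  have W: "\<sigma> \<in> W n k"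
    using \<sigma> pp[of k] by (simp add: W_perm_prod Rk)
  \<comment> \<open>Reading row \<open>i\<close> of \<open>g\<close> in the order \<open>R i\<close>
    makes it decreasing. It has the same values as the decreasing row \<open>i\<close> of
    \<open>m\<close>, so the two coincide.\<close>
  have gR: "g i (inv (R i) x) = Poly_Mapping.lookup m (i, x)" if i: "i \<in> {1..k}" and x: "x \<in> {1..n}" for i x
  proof (rule antitone_eqI[OF _ _ _ x])
    have inv_R: "inv (R i) permutes {1..n}" by (rule permutes_inv[OF R])
    fix a b :: nat assume ab: "1 \<le> a" "a \<le> b" "b \<le> n"
    show "g i (inv (R i) b) \<le> g i (inv (R i) a)"
    proof (cases "a = b")
      case False
      have "inv (R i) a \<in> {1..n}" "inv (R i) b \<in> {1..n}"
        by (rule permutes_mem[OF inv_R], use ab in simp)+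
      from R_less[OF this, of i] have "before g i (inv (R i) a) (inv (R i) b)"
        using ab False by (simp add: permutes_inverses(1)[OF R])
      then show ?thesis using i by (cases i) (auto simp: before_Suc)
    qed simp
    show "Poly_Mapping.lookup m (i, b) \<le> Poly_Mapping.lookup m (i, a)"
      using m i ab by (intro antitone_uptoD[of n "\<lambda>j. Poly_Mapping.lookup m (i, j)"])
        (auto simp: dominant_monoms_def)
  next
    have "image_mset (\<lambda>x. g i (inv (R i) x)) (mset_set {1..n}) =
        image_mset (\<lambda>x. f i (inv r x)) (mset_set {1..n})"
      unfolding image_mset_permutes[OF permutes_inv[OF R]] by (simp only: g_def[abs_def])
    also have "\<dots> = row n M i"
      unfolding image_mset_permutes[OF inv_r] by (simp only: f_def[abs_def] row_def)
    also have "\<dots> = row n m i"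
      using M i by (auto simp: degree_monoms_def multidegree_eq_iff)
    finally show "image_mset (\<lambda>x. g i (inv (R i) x)) (mset_set {1..n}) =
        image_mset (\<lambda>x. Poly_Mapping.lookup m (i, x)) (mset_set {1..n})"
      by (simp add: row_def)
  qed
  have "\<sigma> \<in> W_compat n k m"
  proof -
    have "Poly_Mapping.lookup m (i, Suc j) < Poly_Mapping.lookup m (i, j)"
      if i: "i \<in> {1..k}" and j: "j \<in> Des n (\<sigma> i)" for i j
    proof -
      obtain i' where i': "i = Suc i'" using i by (cases i) auto
      have jn: "j \<in> {1..n}" "Suc j \<in> {1..n}" and des: "R i' (inv (R i) (Suc j)) < R i' (inv (R i) j)"
        using j i i' by (auto simp: Des_def \<sigma>_def)
      let ?a = "inv (R i) j" and ?b = "inv (R i) (Suc j)"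
      have ab: "?a \<in> {1..n}" "?b \<in> {1..n}"
        by (rule permutes_mem[OF permutes_inv[OF R] jn(1)],
            rule permutes_mem[OF permutes_inv[OF R] jn(2)])
      \<comment> \<open>A descent at \<open>j\<close> means that sort \<open>i\<close> exchanged
        these two columns. A stable sort does so only if the new row strictly separates
        them.\<close>
      have "before g i ?a ?b"
        using R_less[OF ab, of i] by (simp add: permutes_inverses(1)[OF R])
      moreover have "\<not> before g i' ?a ?b"
        using R_less[OF ab, of i'] des by simp
      ultimately have "g i ?b < g i ?a"
        by (simp add: i' before_Suc)
      then show ?thesis using gR[OF i] jn by simp
    qed
    then show ?thesis using W by (simp add: W_compat_def)
  qed
  moreover have "columns n k (mk_monom n k (spread m \<sigma>)) = columns n k M"
  proof -
    have "column (spread m \<sigma>) k a = column f k (inv r a)" if a: "a \<in> {1..n}" for a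
      unfolding column_eq_iff
    proof
      fix i assume i: "i \<in> {1..k}"
      have "inv (perm_prod \<sigma> i) = R i"
        using i pp[of i] by (simp add: permutes_inv_inv[OF R])
      moreover have "R i a \<in> {1..n}"
        by (rule permutes_mem[OF R a])
      ultimately show "spread m \<sigma> i a = f i (inv r a)"
        using gR[OF i, of "R i a"] by (simp add: spread_def permutes_inverses(2)[OF R] g_def)
    qed
    then have "columns n k (mk_monom n k (spread m \<sigma>)) =
        image_mset (\<lambda>a. column f k (inv r a)) (mset_set {1..n})"
      unfolding columns_mk_monom by (intro image_mset_cong) auto
    also have "\<dots> = columns n k M"
      unfolding image_mset_permutes[OF inv_r] columns_def f_def[abs_def] ..
    finally show ?thesis .
  qed
  ultimately show ?thesis by blast
qed

lemma card_columns:
  assumes m: "m \<in> dominant_monoms n k"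
  shows "card (columns n k ` degree_monoms n k (multidegree n k m)) = card (W_compat n k m)"
proof -
  have "columns n k ` degree_monoms n k (multidegree n k m) =
      (\<lambda>\<sigma>. columns n k (mk_monom n k (spread m \<sigma>))) ` W_compat n k m" (is "?A = ?B")
  proof
    show "?A \<subseteq> ?B"
      using columns_spread_surj[OF m] by (force simp: image_iff)
    show "?B \<subseteq> ?A"
      by (auto simp: W_compat_def intro!: imageI spread_in_degree_monoms)
  qed
  then show ?thesis by (simp add: card_image[OF inj_on_columns_spread[OF m]])
qed

section \<open>Orbits of the two groups\<close>

lemma Sym_diag_subset: "Sym_diag n k \<subseteq> Sym_pow n k"
  by (auto simp: Sym_diag_def Sym_pow_def)

text \<open>Equal column multisets are matched by a permutation of the columns, and this one
  permutation serves every row.\<close>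

lemma dim_graded_part_diag:
  assumes "m \<in> dominant_monoms n k"
  shows "cpoly.dim (graded_part n k (Sym_diag n k) (multidegree n k m)) = card (W_compat n k m)"
proof -
  let ?X = "degree_monoms n k (multidegree n k m)"
  have "cpoly.dim (graded_part n k (Sym_diag n k) (multidegree n k m)) = card (columns n k ` ?X)"
  proof (rule dim_graded_part[OF Sym_diag_subset])
    fix M N assume "M \<in> ?X" "N \<in> ?X"
    then have MN: "M \<in> monoms n k" "N \<in> monoms n k" by (auto simp: degree_monoms_def)
    have act: "act_monom (\<lambda>i\<in>{1..k}. p) M = N \<longleftrightarrow>
        (\<forall>i\<in>{1..k}. \<forall>j\<in>{1..n}. Poly_Mapping.lookup N (i, p j) = Poly_Mapping.lookup M (i, j))"
      if "p \<in> Sym n" for p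
    proof -
      have "(\<lambda>i\<in>{1..k}. p) \<in> Sym_pow n k" using that by (auto simp: Sym_pow_def)
      from act_monom_eq_iff[OF this MN] show ?thesis by simp
    qed
    show "columns n k M = columns n k N \<longleftrightarrow> (\<exists>\<sigma>\<in>Sym_diag n k. act_monom \<sigma> M = N)"
    proof
      assume eq: "columns n k M = columns n k N"
      obtain p where p: "p permutes {1..n}" and
        "\<forall>a\<in>{1..n}. column (\<lambda>i j. Poly_Mapping.lookup M (i, j)) k a =
          column (\<lambda>i j. Poly_Mapping.lookup N (i, j)) k (p a)"
        by (rule image_mset_eq_implies_permutes[OF finite_atLeastAtMost eq[unfolded columns_def]])
      then have "act_monom (\<lambda>i\<in>{1..k}. p) M = N"
        using act[of p] by (simp add: column_eq_iff Sym_def)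
      then show "\<exists>\<sigma>\<in>Sym_diag n k. act_monom \<sigma> M = N"
        using p by (auto simp: Sym_diag_def Sym_def)
    next
      assume "\<exists>\<sigma>\<in>Sym_diag n k. act_monom \<sigma> M = N"
      then obtain p where p: "p \<in> Sym n" "act_monom (\<lambda>i\<in>{1..k}. p) M = N"
        by (auto simp: Sym_diag_def)
      have "columns n k M = image_mset (\<lambda>a. column (\<lambda>i j. Poly_Mapping.lookup N (i, j)) k (p a)) (mset_set {1..n})"
        unfolding columns_def using p act[OF p(1)]
        by (intro image_mset_cong) (auto simp: column_eq_iff)
      also have "\<dots> = columns n k N"
        using p(1) by (simp add: columns_def image_mset_permutes Sym_def)
      finally show "columns n k M = columns n k N" .
    qed
  qed
  then show ?thesis by (simp add: card_columns[OF assms])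
qed

text \<open>Rows are permuted independently, so equal row multisets put all monomials of the degree
  in one orbit. A constant map is then a complete invariant.\<close>

lemma dim_graded_part_pow:
  assumes "m \<in> dominant_monoms n k"
  shows "cpoly.dim (graded_part n k (Sym_pow n k) (multidegree n k m)) = 1"
proof -
  let ?X = "degree_monoms n k (multidegree n k m)"
  have "cpoly.dim (graded_part n k (Sym_pow n k) (multidegree n k m)) = card ((\<lambda>_. ()) ` ?X)"
  proof (rule dim_graded_part[OF order_refl])
    fix M N assume MN: "M \<in> ?X" "N \<in> ?X"
    then have MN': "M \<in> monoms n k" "N \<in> monoms n k" by (auto simp: degree_monoms_def)
    have "\<exists>p. p permutes {1..n} \<and>
        (\<forall>j\<in>{1..n}. Poly_Mapping.lookup M (i, j) = Poly_Mapping.lookup N (i, p j))"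
      if "i \<in> {1..k}" for i
    proof -
      have "row n M i = row n N i"
        using MN that by (auto simp: degree_monoms_def multidegree_eq_iff)
      from image_mset_eq_implies_permutes[OF finite_atLeastAtMost this[unfolded row_def]]
      show ?thesis by blast
    qed
    then obtain p where p: "\<And>i. i \<in> {1..k} \<Longrightarrow> p i permutes {1..n}"
      "\<And>i j. i \<in> {1..k} \<Longrightarrow> j \<in> {1..n} \<Longrightarrow> Poly_Mapping.lookup M (i, j) = Poly_Mapping.lookup N (i, p i j)"
      by metis
    have "restrict p {1..k} \<in> Sym_pow n k"
      using p(1) by (auto simp: Sym_pow_def Sym_def)
    then show "() = () \<longleftrightarrow> (\<exists>\<sigma>\<in>Sym_pow n k. act_monom \<sigma> M = N)"
      using act_monom_eq_iff[OF _ MN', of "restrict p {1..k}"] p(2) by auto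
  qed
  \<comment> \<open>\<open>m\<close> itself has this degree, so the orbit exists.\<close>
  also have "(\<lambda>_. ()) ` ?X = {()}"
    using assms by (auto simp: degree_monoms_def dominant_monoms_def)
  finally show ?thesis by simp
qed

section \<open>The Hilbert series\<close>

definition exponent :: "nat \<Rightarrow> nat \<Rightarrow> (nat \<Rightarrow> nat list) \<Rightarrow> monom" where
  "exponent n k L = mk_monom n k (\<lambda>i j. L i ! (j - 1))"

lemma partition_rev_sort:
  assumes "antitone_upto n g"
  shows "rev (sort (map g [1..<Suc n])) = map g [1..<Suc n]"
    and "map g [1..<Suc n] \<in> partitions n"
proof -
  have sorted: "sorted_wrt (\<ge>) (map g [1..<Suc n])"
    unfolding sorted_wrt_map
    by (rule sorted_wrt_mono_rel[OF _ sorted_wrt_upt]) (auto intro: antitone_uptoD[OF assms])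
  then show "map g [1..<Suc n] \<in> partitions n"
    by (simp add: partitions_def del: upt_Suc)
  have "sorted (rev (map g [1..<Suc n]))"
    using sorted unfolding sorted_wrt_rev by simp
  then have "sort (map g [1..<Suc n]) = rev (map g [1..<Suc n])"
    by (intro properties_for_sort) simp_all
  then show "rev (sort (map g [1..<Suc n])) = map g [1..<Suc n]"
    by (simp only: rev_rev_ident)
qed

lemma partition_map_nth:
  assumes "l \<in> partitions n"
  shows "map (\<lambda>j. l ! (j - 1)) [1..<Suc n] = l" and "antitone_upto n (\<lambda>j. l ! (j - 1))"
  using assms
  by (auto simp: partitions_def antitone_upto_def sorted_wrt_iff_nth_less simp del: upt_Suc
      intro!: nth_equalityI)

text \<open>With \<open>multidegree_dominant\<close>, this makes \<open>exponent\<close> and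
  \<open>multidegree\<close> inverse bijections between multipartitions and dominant
  monomials.\<close>

lemma exponent_multipartition:
  assumes "\<Lambda> \<in> multipartitions n k"
  shows "exponent n k \<Lambda> \<in> dominant_monoms n k" and "multidegree n k (exponent n k \<Lambda>) = \<Lambda>"
proof -
  have part: "\<Lambda> i \<in> partitions n" if "i \<in> {1..k}" for i
    using assms that by (auto simp: multipartitions_def)
  have anti: "antitone_upto n (\<lambda>j. Poly_Mapping.lookup (exponent n k \<Lambda>) (i, j))" if "i \<in> {1..k}" for i
    using partition_map_nth(2)[OF part[OF that]] that
    by (auto simp: antitone_upto_def exponent_def lookup_mk_monom)
  then show "exponent n k \<Lambda> \<in> dominant_monoms n k"
    by (simp add: dominant_monoms_def) (simp add: exponent_def mk_monom_in_monoms)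
  show "multidegree n k (exponent n k \<Lambda>) = \<Lambda>"
  proof (rule extensionalityI[of _ "{1..k}"])
    show "multidegree n k (exponent n k \<Lambda>) \<in> extensional {1..k}"
      by (simp add: multidegree_def)
    show "\<Lambda> \<in> extensional {1..k}"
      using assms by (auto simp: multipartitions_def PiE_def)
    fix i assume i: "i \<in> {1..k}"
    have "map (\<lambda>j. Poly_Mapping.lookup (exponent n k \<Lambda>) (i, j)) [1..<Suc n] =
        map (\<lambda>j. \<Lambda> i ! (j - 1)) [1..<Suc n]"
      by (rule map_cong[OF refl]) (use i in \<open>auto simp: exponent_def lookup_mk_monom simp del: upt_Suc\<close>)
    also have "\<dots> = \<Lambda> i" by (rule partition_map_nth(1)[OF part[OF i]])
    finally show "multidegree n k (exponent n k \<Lambda>) i = \<Lambda> i"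
      using partition_rev_sort(1)[OF anti[OF i]] i by (simp add: multidegree_def del: upt_Suc)
  qed
qed

lemma multidegree_dominant:
  assumes m: "m \<in> dominant_monoms n k"
  shows "multidegree n k m \<in> multipartitions n k" and "exponent n k (multidegree n k m) = m"
proof -
  have md: "multidegree n k m i = map (\<lambda>j. Poly_Mapping.lookup m (i, j)) [1..<Suc n]"
    and part: "multidegree n k m i \<in> partitions n" if "i \<in> {1..k}" for i
  proof -
    have "antitone_upto n (\<lambda>j. Poly_Mapping.lookup m (i, j))"
      using m that by (simp add: dominant_monoms_def)
    from partition_rev_sort[OF this] that
    show "multidegree n k m i = map (\<lambda>j. Poly_Mapping.lookup m (i, j)) [1..<Suc n]"
      "multidegree n k m i \<in> partitions n"
      by (simp_all add: multidegree_def del: upt_Suc)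
  qed
  show "multidegree n k m \<in> multipartitions n k"
    using part by (auto simp: multipartitions_def multidegree_def)
  have "m \<in> monoms n k" using m by (simp add: dominant_monoms_def)
  then show "exponent n k (multidegree n k m) = m"
    by (intro monoms_eqI[of _ n k])
      (auto simp: exponent_def mk_monom_in_monoms lookup_mk_monom md simp del: upt_Suc)
qed

text \<open>A monomial determines its multipartition, so the defining sum has one term at dominant
  \<open>m\<close> and none elsewhere.\<close>

lemma coeff_Hilb:
  "mfps_coeff (Hilb n k G) m =
    (if m \<in> dominant_monoms n k then int (cpoly.dim (graded_part n k G (multidegree n k m))) else 0)"
proof -
  have coeff: "mfps_coeff (\<Prod>i=1..k. Qpow n i (\<Lambda> i)) m = (if m = exponent n k \<Lambda> then 1 else 0)" for \<Lambda>
    unfolding prod_Qpow coeff_mfps_monom exponent_def ..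
  have support: "{\<Lambda>. \<Lambda> \<in> multipartitions n k \<and> (if m = exponent n k \<Lambda> then 1 else 0) \<noteq> (0::int)} =
      (if m \<in> dominant_monoms n k then {multidegree n k m} else {})"
    using exponent_multipartition[of _ n k] multidegree_dominant[of m n k] by (auto split: if_splits)
  show ?thesis
    unfolding Hilb_def mfps_coeff_Abs coeff support by (simp add: multidegree_dominant(2))
qed

section \<open>Splitting off a descent exponent\<close>

definition des_exponent :: "nat \<Rightarrow> nat \<Rightarrow> (nat \<Rightarrow> nat \<Rightarrow> nat) \<Rightarrow> monom" where
  "des_exponent n k \<sigma> = mk_monom n k (\<lambda>i j. card (Des n (\<sigma> i) \<inter> {j..n}))"

lemma prod_Qpow_des_partition:
  "(\<Prod>i=1..k. Qpow n i (des_partition n (\<sigma> i))) = mfps_monom (des_exponent n k \<sigma>)"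
  unfolding prod_Qpow des_exponent_def
  by (rule arg_cong[of _ _ mfps_monom], rule mk_monom_cong)
    (auto simp: des_partition_def simp del: upt_Suc)

lemma card_Des_step:
  assumes "j \<le> n"
  shows "card (Des n s \<inter> {j..n}) = card (Des n s \<inter> {Suc j..n}) + (if j \<in> Des n s then 1 else 0)"
proof -
  have "Des n s \<inter> {j..n} = (if j \<in> Des n s then insert j (Des n s \<inter> {Suc j..n}) else Des n s \<inter> {Suc j..n})"
    using assms atLeastAtMost_insertL[OF assms] by auto
  then show ?thesis by simp
qed

lemma card_Des_top: "card (Des n s \<inter> {n..n}) = 0"
  by (auto simp: Des_def)

text \<open>Going down from \<open>j = n\<close>, where no descent is left, each descent raises the
  count by one and \<open>L\<close> by at least one.\<close>

lemma des_le:
  assumes L: "antitone_upto n L" and D: "\<And>j. j \<in> Des n s \<Longrightarrow> L (Suc j) < L j"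
    and j: "1 \<le> j" "j \<le> n"
  shows "card (Des n s \<inter> {j..n}) \<le> L j"
  using j(2,1)
proof (induction j rule: inc_induct)
  case base
  then show ?case by (simp only: card_Des_top)
next
  case (step j)
  then have "L (Suc j) \<le> L j" using L by (simp add: antitone_upto_def)
  then show ?case
    using card_Des_step[of j n s] D[of j] step by (cases "j \<in> Des n s") simp_all
qed

text \<open>Adding the descent exponent raises the drop between neighbouring exponents by one
  exactly at the descents, so the remainder is dominant when \<open>m\<close> drops weakly
  everywhere and strictly there.\<close>

lemma dominant_split:
  assumes m: "m \<in> monoms n k" and \<sigma>: "\<sigma> \<in> W n k"
  shows "(\<exists>a\<in>dominant_monoms n k. a + des_exponent n k \<sigma> = m) \<longleftrightarrow>
    m \<in> dominant_monoms n k \<and> \<sigma> \<in> W_compat n k m"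
proof
  assume "\<exists>a\<in>dominant_monoms n k. a + des_exponent n k \<sigma> = m"
  then obtain a where a: "a \<in> dominant_monoms n k" and am: "a + des_exponent n k \<sigma> = m" by blast
  have step: "Poly_Mapping.lookup m (i, Suc j) + (if j \<in> Des n (\<sigma> i) then 1 else 0) \<le> Poly_Mapping.lookup m (i, j)"
    if "i \<in> {1..k}" "j \<in> {1..<n}" for i j
  proof -
    have "Poly_Mapping.lookup a (i, Suc j) \<le> Poly_Mapping.lookup a (i, j)"
      using a that by (auto simp: dominant_monoms_def antitone_upto_def)
    then show ?thesis
      using that card_Des_step[of j n "\<sigma> i"]
      by (simp add: lookup_add des_exponent_def lookup_mk_monom flip: am)
  qed
  have "Des n (\<sigma> i) \<subseteq> {1..<n}" for i
    by (auto simp: Des_def)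
  then show "m \<in> dominant_monoms n k \<and> \<sigma> \<in> W_compat n k m"
    using step m \<sigma> unfolding dominant_monoms_def W_compat_def antitone_upto_def
    by (fastforce split: if_splits)
next
  assume *: "m \<in> dominant_monoms n k \<and> \<sigma> \<in> W_compat n k m"
  let ?L = "\<lambda>i j. Poly_Mapping.lookup m (i, j)" and ?d = "\<lambda>i j. card (Des n (\<sigma> i) \<inter> {j..n})"
  have anti: "antitone_upto n (?L i)" and D: "\<And>j. j \<in> Des n (\<sigma> i) \<Longrightarrow> ?L i (Suc j) < ?L i j"
    if "i \<in> {1..k}" for i
    using * that by (auto simp: dominant_monoms_def W_compat_def)
  \<comment> \<open>Truncated subtraction is exact here by \<open>des_le\<close>.\<close>
  let ?a = "mk_monom n k (\<lambda>i j. ?L i j - ?d i j)"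
  have "?a + des_exponent n k \<sigma> = mk_monom n k ?L"
    unfolding des_exponent_def mk_monom_add
    by (rule mk_monom_cong) (use des_le[OF anti D] in auto)
  then have "?a + des_exponent n k \<sigma> = m"
    by (simp add: mk_monom_lookup m)
  moreover have "?a \<in> dominant_monoms n k"
  proof -
    have "?L i (Suc j) - ?d i (Suc j) \<le> ?L i j - ?d i j" if i: "i \<in> {1..k}" and j: "j \<in> {1..<n}" for i j
    proof -
      have "?L i (Suc j) \<le> ?L i j" using anti[OF i] j by (simp add: antitone_upto_def)
      then show ?thesis using D[OF i, of j] card_Des_step[of j n "\<sigma> i"] j by auto
    qed
    then show ?thesis
      by (auto simp: dominant_monoms_def mk_monom_in_monoms antitone_upto_def lookup_mk_monom)
  qed
  ultimately show "\<exists>a\<in>dominant_monoms n k. a + des_exponent n k \<sigma> = m" by blast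
qed

lemma finite_W: "finite (W n k)"
proof (rule finite_subset)
  show "W n k \<subseteq> Sym_pow n k" by (auto simp: W_def)
  show "finite (Sym_pow n k)"
    unfolding Sym_pow_def Sym_def by (intro finite_PiE finite_permutations) auto
qed

text \<open>At dominant \<open>m\<close> the left-hand coefficient counts \<open>W_compat\<close>.
  The series of \<open>Sym_pow\<close> has coefficient 1 at every dominant monomial, so a tuple
  contributes on the right exactly when \<open>m\<close> splits as in
  \<open>dominant_split\<close>.\<close>

lemma Hilb_diag_eq:
  "Hilb n k (Sym_diag n k) =
    Hilb n k (Sym_pow n k) * (\<Sum>\<sigma>\<in>W n k. mfps_monom (des_exponent n k \<sigma>))"
proof (rule mfps_eqI)
  fix m
  let ?P = "dominant_monoms n k"
  have coeff: "mfps_coeff (Hilb n k (Sym_pow n k) * mfps_monom (des_exponent n k \<sigma>)) m =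
      (if m \<in> ?P \<and> \<sigma> \<in> W_compat n k m then 1 else 0)" if \<sigma>: "\<sigma> \<in> W n k" for \<sigma>
  proof -
    let ?e = "des_exponent n k \<sigma>"
    have split: "(\<exists>a\<in>?P. a + ?e = m) \<longleftrightarrow> m \<in> ?P \<and> \<sigma> \<in> W_compat n k m"
    proof (cases "m \<in> monoms n k")
      case False
      have "a + ?e \<in> monoms n k" if "a \<in> ?P" for a
      proof -
        have "a \<in> monoms n k" "?e \<in> monoms n k"
          using that by (simp_all add: dominant_monoms_def des_exponent_def mk_monom_in_monoms)
        then show ?thesis using Poly_Mapping.keys_add[of a ?e] by (auto simp: monoms_def)
      qed
      then show ?thesis using False by (auto simp: dominant_monoms_def)
    qed (rule dominant_split[OF _ \<sigma>])
    have "mfps_coeff (Hilb n k (Sym_pow n k) * mfps_monom ?e) m =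
        (\<Sum>a | a + ?e = m. if a \<in> ?P then 1 else 0)"
      by (auto simp: mfps_coeff_mult_monom coeff_Hilb dim_graded_part_pow intro!: sum.cong)
    also have "{a. a + ?e = m} = (if \<exists>a. a + ?e = m then {m - ?e} else {})"
      by auto
    also have "(\<Sum>a\<in>\<dots>. if a \<in> ?P then 1 else 0) = (if \<exists>a\<in>?P. a + ?e = m then 1 else (0::int))"
      by auto
    finally show ?thesis unfolding split .
  qed
  have "mfps_coeff (Hilb n k (Sym_pow n k) * (\<Sum>\<sigma>\<in>W n k. mfps_monom (des_exponent n k \<sigma>))) m =
      (\<Sum>\<sigma>\<in>W n k. if m \<in> ?P \<and> \<sigma> \<in> W_compat n k m then 1 else 0)"
    by (simp add: sum_distrib_left mfps_coeff_sum coeff)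
  also have "\<dots> = (if m \<in> ?P then int (card {\<sigma> \<in> W n k. \<sigma> \<in> W_compat n k m}) else 0)"
    by (simp add: finite_W flip: sum.inter_filter)
  also have "{\<sigma> \<in> W n k. \<sigma> \<in> W_compat n k m} = W_compat n k m"
    by (auto simp: W_compat_def)
  finally show "mfps_coeff (Hilb n k (Sym_diag n k)) m =
      mfps_coeff (Hilb n k (Sym_pow n k) * (\<Sum>\<sigma>\<in>W n k. mfps_monom (des_exponent n k \<sigma>))) m"
    by (simp add: coeff_Hilb dim_graded_part_diag)
qed

theorem theorem3p6:
  fixes n k :: nat
  assumes "n \<ge> 1" and "k \<ge> 1"
  shows "Hilb n k (Sym_diag n k) / Hilb n k (Sym_pow n k) =
    (\<Sum>\<sigma>\<in>W n k. \<Prod>i=1..k. Qpow n i (des_partition n (\<sigma> i)))"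
proof -
  let ?H = "Hilb n k (Sym_pow n k)" and ?S = "\<Sum>\<sigma>\<in>W n k. mfps_monom (des_exponent n k \<sigma>)"
  \<comment> \<open>The exponent 0 is dominant, so the denominator has constant term 1 and is a
    unit. Division is therefore genuine and does not fall back to its default value 0.\<close>
  have "0 \<in> dominant_monoms n k"
    by (simp add: dominant_monoms_def monoms_def antitone_upto_def)
  then have "mfps_coeff ?H 0 = 1"
    by (simp add: coeff_Hilb dim_graded_part_pow)
  then obtain g where g: "?H * g = 1"
    using mfps_is_unit by blast
  have "Hilb n k (Sym_diag n k) / ?H = ?H * ?S * g"
    by (simp add: divide_mfps_def mfps_inverse_unique[OF g] Hilb_diag_eq)
  also have "\<dots> = (?H * g) * ?S"
    by (simp only: ac_simps)
  finally show ?thesis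
    unfolding prod_Qpow_des_partition g by simp
qed

end
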